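(* Assume $0<a<b<\infty$. For all $g\in\mathcal N$, $\underline I_{[0,1]^d}(g)=\overline I_{[0,1]^d}(g)$.
   Context: Let $d\ge2$ be an integer and $\mathbb E^d$ the set of non-oriented nearest-neighbour edges of $\mathbb Z^d$. Let $\nu$ be a probability distribution on $[0,\infty)$, and let $a$ and $b$ be the infimum and supremum of its support. Let $(\tau_e)_{e\in\mathbb E^d}$ be i.i.d. random variables with distribution $\nu$. Write $\|x\|=\sum_{i=1}^d|x_i|$ on $\mathbb R^d$. For $z,z'\in\mathbb R^d$, let $\tau(z,z')=\tau_{(v,v')}\|z-z'\|$ if there exist adjacent vertices $v,v'\in\mathbb Z^d$ such that $z,z'$ belong to the segment $[v,v']$, and $\tau(z,z')=b\|z-z'\|$ otherwise. For a finite sequence $\pi=(x_0,\dots,x_r)$ of points of $\mathbb R^d$, let $\tau(\pi)=\sum_{i=0}^{r-1}\tau(x_i,x_{i+1})$. For a compact convex set $X\subset\mathbb R^d$ with nonempty interior and $x,y\in X$, $\mathbf T_X(x,y)$ is the infimum of $\tau(\pi)$ over all finite sequences $\pi$ of points of $X$ with endpoints $x$ and $y$, and $\widetilde{\mathbf T}_{n,X}(x,y)=\frac1n\mathbf T_{nX}(nx,ny)$ for $n\ge1$. $\mathcal N$ is the set of norms $g$ on $\mathbb R^d$ such that $a\|\cdot\|\le g\le b\|\cdot\|$. For $g\in\mathcal N$ and $\varepsilon>0$, let $$\mathrm{LD}_{n,[0,1]^d}(g,\varepsilon)=\left\{\max_{x,y\in[0,1]^d}\left|g(x-y)-\widetilde{\mathbf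 T}_{n,[0,1]^d}(x,y)\right|\le\varepsilon\right\},$$ $$\underline I_{[0,1]^d}(g)=\lim_{\varepsilon\to0}\liminf_{n\to\infty}-\frac1{n^d}\log\mathbb P(\mathrm{LD}_{n,[0,1]^d}(g,\varepsilon)),\qquad \overline I_{[0,1]^d}(g)=\lim_{\varepsilon\to0}\limsup_{n\to\infty}-\frac1{n^d}\log\mathbb P(\mathrm{LD}_{n,[0,1]^d}(g,\varepsilon)),$$ with values in $[0,\infty]$; the limits as $\varepsilon\to0$ are monotone (increasing as $\varepsilon$ decreases). *)

theory Defs
  imports "HOL-Probability.Probability"
begin

definition l1norm :: "real ^ 'n \<Rightarrow> real" where
  "l1norm x = (\<Sum>i\<in>UNIV. \<bar>x $ i\<bar>)"

definition lattice :: "(real ^ 'n) set" where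
  "lattice = {v. \<forall>i. v $ i \<in> \<int>}"

text \<open>A non-oriented edge is the unordered pair of its endpoints; its segment is then
  the convex hull of that pair.\<close>

definition edges :: "(real ^ 'n) set set" where
  "edges = {{v, w} | v w. v \<in> lattice \<and> w \<in> lattice \<and> l1norm (v - w) = 1}"

definition law_on_nonneg :: "real measure \<Rightarrow> bool" where
  "law_on_nonneg \<nu> \<longleftrightarrow> prob_space \<nu> \<and> sets \<nu> = sets (restrict_space borel {0..})"

definition law_support :: "real measure \<Rightarrow> real set" where
  "law_support \<nu> =
     {x \<in> space \<nu>. \<forall>U. open U \<longrightarrow> x \<in> U \<longrightarrow> 0 < measure \<nu> (U \<inter> space \<nu>)}"

text \<open>Measurability into \<open>\<nu>\<close>, whose space is \<open>{0..}\<close> when \<open>law_on_nonneg \<nu>\<close> holds, makes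
  the passage times nonnegative everywhere on \<open>space M\<close>.\<close>

definition iid_passage_times ::
  "'w measure \<Rightarrow> real measure \<Rightarrow> ((real ^ 'n) set \<Rightarrow> 'w \<Rightarrow> real) \<Rightarrow> bool" where
  "iid_passage_times M \<nu> \<tau> \<longleftrightarrow>
     prob_space.indep_vars M (\<lambda>_. \<nu>) \<tau> edges \<and> (\<forall>e\<in>edges. distr M \<nu> (\<tau> e) = \<nu>)"

text \<open>In the following definitions \<open>t\<close> is a realisation of the passage times and \<open>b\<close> the price
  per unit length of a step that does not follow an edge.  The edge selected in \<open>step_time\<close> is
  unique unless \<open>z = z'\<close>, in which case the time is \<open>0\<close> whatever the choice.\<close>

definition step_time ::
  "real \<Rightarrow> ((real ^ 'n) set \<Rightarrow> real) \<Rightarrow> real ^ 'n \<Rightarrow> real ^ 'n \<Rightarrow> real" where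
  "step_time b t z z' =
     (if \<exists>e\<in>edges. z \<in> convex hull e \<and> z' \<in> convex hull e
      then t (SOME e. e \<in> edges \<and> z \<in> convex hull e \<and> z' \<in> convex hull e) * l1norm (z - z')
      else b * l1norm (z - z'))"

definition path_time ::
  "real \<Rightarrow> ((real ^ 'n) set \<Rightarrow> real) \<Rightarrow> (real ^ 'n) list \<Rightarrow> real" where
  "path_time b t p = (\<Sum>i<length p - 1. step_time b t (p ! i) (p ! Suc i))"

definition passage_time ::
  "real \<Rightarrow> ((real ^ 'n) set \<Rightarrow> real) \<Rightarrow> (real ^ 'n) set \<Rightarrow> real ^ 'n \<Rightarrow> real ^ 'n \<Rightarrow> real" where
  "passage_time b t X x y =
     Inf {path_time b t p | p. p \<noteq> [] \<and> set p \<subseteq> X \<and> hd p = x \<and> last p = y}"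

definition rescaled_passage_time ::
  "real \<Rightarrow> ((real ^ 'n) set \<Rightarrow> real) \<Rightarrow> nat \<Rightarrow> (real ^ 'n) set \<Rightarrow> real ^ 'n \<Rightarrow> real ^ 'n \<Rightarrow> real" where
  "rescaled_passage_time b t n X x y =
     passage_time b t ((\<lambda>z. real n *\<^sub>R z) ` X) (real n *\<^sub>R x) (real n *\<^sub>R y) / real n"

definition is_norm :: "(real ^ 'n \<Rightarrow> real) \<Rightarrow> bool" where
  "is_norm g \<longleftrightarrow>
     (\<forall>x. 0 \<le> g x) \<and> (\<forall>x. g x = 0 \<longleftrightarrow> x = 0) \<and>
     (\<forall>c x. g (c *\<^sub>R x) = \<bar>c\<bar> * g x) \<and> (\<forall>x y. g (x + y) \<le> g x + g y)"

definition admissible_norms :: "real \<Rightarrow> real \<Rightarrow> (real ^ 'n \<Rightarrow> real) set" where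
  "admissible_norms a b =
     {g. is_norm g \<and> (\<forall>x. a * l1norm x \<le> g x \<and> g x \<le> b * l1norm x)}"

definition unit_cube :: "(real ^ 'n) set" where
  "unit_cube = {x. \<forall>i. 0 \<le> x $ i \<and> x $ i \<le> 1}"

definition LD_event ::
  "'w measure \<Rightarrow> ((real ^ 'n) set \<Rightarrow> 'w \<Rightarrow> real) \<Rightarrow> real \<Rightarrow> (real ^ 'n) set \<Rightarrow> nat
     \<Rightarrow> (real ^ 'n \<Rightarrow> real) \<Rightarrow> real \<Rightarrow> 'w set" where
  "LD_event M \<tau> b X n g \<epsilon> =
     {\<omega> \<in> space M.
        (SUP x\<in>X. SUP y\<in>X.
           ereal \<bar>g (x - y) - rescaled_passage_time b (\<lambda>e. \<tau> e \<omega>) n X x y\<bar>) \<le> ereal \<epsilon>}"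

text \<open>Minus the logarithm of a probability; the case distinction is needed because
  \<open>ln 0 = 0\<close> for the real logarithm.\<close>

definition neg_log :: "real \<Rightarrow> ereal" where
  "neg_log p = (if p = 0 then \<infinity> else ereal (- ln p))"

definition LD_rate ::
  "'w measure \<Rightarrow> ((real ^ 'n) set \<Rightarrow> 'w \<Rightarrow> real) \<Rightarrow> real \<Rightarrow> (real ^ 'n) set
     \<Rightarrow> (real ^ 'n \<Rightarrow> real) \<Rightarrow> real \<Rightarrow> nat \<Rightarrow> ereal" where
  "LD_rate M \<tau> b X g \<epsilon> n =
     neg_log (measure M (LD_event M \<tau> b X n g \<epsilon>)) / ereal (real n ^ CARD('n))"

definition lower_rate ::
  "'w measure \<Rightarrow> ((real ^ 'n) set \<Rightarrow> 'w \<Rightarrow> real) \<Rightarrow> real \<Rightarrow> (real ^ 'n) set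
     \<Rightarrow> (real ^ 'n \<Rightarrow> real) \<Rightarrow> ereal" where
  "lower_rate M \<tau> b X g = Lim (at_right 0) (\<lambda>\<epsilon>. liminf (LD_rate M \<tau> b X g \<epsilon>))"

definition upper_rate ::
  "'w measure \<Rightarrow> ((real ^ 'n) set \<Rightarrow> 'w \<Rightarrow> real) \<Rightarrow> real \<Rightarrow> (real ^ 'n) set
     \<Rightarrow> (real ^ 'n \<Rightarrow> real) \<Rightarrow> ereal" where
  "upper_rate M \<tau> b X g = Lim (at_right 0) (\<lambda>\<epsilon>. limsup (LD_rate M \<tau> b X g \<epsilon>))"

end

theory Submission
  imports Defs
begin

text \<open>
  Tile \<open>[0, N]\<^sup>d\<close> by cores of side \<open>n\<close> separated by corridors of width \<open>m\<close>, with \<open>m / n\<close> small.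
  Suppose that in every core the passage time is within \<open>\<delta> n\<close> of \<open>g\<close>, and that all edges outside the
  cores have passage times close to \<open>b\<close>.  Then the passage time in the large cube is close to \<open>g\<close>:
  a path that changes cores has to cross a corridor, which costs slightly more than \<open>g\<close> and
  pays for the error \<open>\<delta> n\<close> made in the core; conversely, following a straight line through the cores
  and jumping over the corridors is cheap enough.  The cores are disjoint, so this configuration has
  probability \<open>P\<^sub>n(\<delta>)\<close> to the number of cores, times a constant to the number of corridor edges,
  which is a small fraction of \<open>N\<^sup>d\<close>.  Hence the limsup of the rates is at most the value
  at a single well chosen \<open>n\<close>, up to arbitrarily small errors.
\<close>

section \<open>Passage times\<close>

text \<open>A path may enter and leave cores arbitrarily often, so the errors made in the cores
  cannot simply be summed over the visits: every change of core must pay for itself. As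
  \<open>g\<close> may equal \<open>b * l1norm\<close> in some directions, even a corridor with all
  times equal to \<open>b\<close> gives no surplus over \<open>g\<close> there. The comparison is
  therefore made with \<open>lam * g\<close> for some \<open>lam < 1\<close>; crossing a gap of
  width \<open>m\<close> then leaves a surplus of at least \<open>(\<beta> - lam * b) * m\<close>,
  which has to cover \<open>\<delta> * n\<close>. The threshold \<open>\<beta>\<close> lies strictly
  below \<open>b\<close>, because the value \<open>b\<close> itself may have probability zero under
  \<open>\<nu>\<close>, whereas times above any \<open>\<beta> < b\<close> have positive
  probability. This dictates the order of the choices: \<open>lam\<close> and \<open>\<beta>\<close>
  from \<open>\<epsilon>\<close>; then the ratio \<open>m / n\<close>, so small that the corridors
  carry a negligible share of the logarithm of the probability; then \<open>\<delta>\<close>, small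
  compared with that ratio; only then \<open>n\<close>, taken from the liminf at
  \<open>\<delta>\<close>; and finally \<open>N\<close> tends to infinity.\<close>

lemma l1norm_triangle: "l1norm (x + y) \<le> l1norm x + l1norm y"
  unfolding l1norm_def by (simp add: sum.distrib[symmetric] sum_mono abs_triangle_ineq)

lemma l1norm_nonneg [simp]: "0 \<le> l1norm x"
  unfolding l1norm_def by (simp add: sum_nonneg)

lemma l1norm_0 [simp]: "l1norm 0 = 0"
  unfolding l1norm_def by simp

lemma l1norm_minus_commute: "l1norm (x - y) = l1norm (y - x)"
  unfolding l1norm_def by (simp add: abs_minus_commute)

lemma l1norm_triangle_via: "l1norm (x - z) \<le> l1norm (x - y) + l1norm (y - z)"
  using l1norm_triangle[of "x - y" "y - z"] by simp

lemma abs_component_le_l1norm: "\<bar>x $ i\<bar> \<le> l1norm x"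
  unfolding l1norm_def by (rule member_le_sum) auto

lemma l1norm_le_card:
  fixes x :: "real ^ 'n"
  assumes "\<And>i. \<bar>x $ i\<bar> \<le> r"
  shows "l1norm x \<le> real CARD('n) * r"
  unfolding l1norm_def using sum_bounded_above[of UNIV "\<lambda>i. \<bar>x $ i\<bar>" r] assms by simp

lemma l1norm_axis [simp]: "l1norm (axis i c) = \<bar>c\<bar>"
  unfolding l1norm_def axis_def by (simp add: if_distrib[of abs] cong: if_cong)

lemma continuous_l1norm: "continuous_on UNIV (l1norm :: real ^ 'n \<Rightarrow> real)"
  unfolding l1norm_def by (intro continuous_intros)

text \<open>Endpoints have integer coordinates, so each coordinate in which they differ contributes
  at least 1 to the l1 distance 1: exactly one does. As edges are unordered, the lower endpoint can
  be taken as base point, which gives one canonical form for all later coordinate arguments.\<close>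

lemma edgesE:
  assumes "e \<in> (edges :: (real ^ 'n) set set)"
  obtains v i where "v \<in> lattice" "e = {v, v + axis i 1}"
proof -
  obtain v w where e: "e = {v, w}" and v: "v \<in> lattice" and w: "w \<in> lattice"
    and d: "l1norm (v - w) = 1"
    using assms unfolding edges_def by auto
  have "v \<noteq> w" using d by auto
  then obtain i where i: "v $ i \<noteq> w $ i" by (auto simp: vec_eq_iff)
  have int: "v $ j - w $ j \<in> \<int>" for j
    using v w unfolding lattice_def by auto
  have ge: "1 \<le> \<bar>v $ i - w $ i\<bar>"
    using int[of i] i Ints_nonzero_abs_ge1[of "v $ i - w $ i"] by simp
  have split: "l1norm (v - w) = \<bar>v $ i - w $ i\<bar> + (\<Sum>j\<in>UNIV - {i}. \<bar>v $ j - w $ j\<bar>)"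
    unfolding l1norm_def by (subst sum.remove[of UNIV i]) auto
  have "(\<Sum>j\<in>UNIV - {i}. \<bar>v $ j - w $ j\<bar>) = 0"
    using split ge d sum_nonneg[of "UNIV - {i}" "\<lambda>j. \<bar>v $ j - w $ j\<bar>", OF abs_ge_zero] by linarith
  then have eq: "v $ j = w $ j" if "j \<noteq> i" for j
    using that by (subst (asm) sum_nonneg_eq_0_iff) auto
  have "\<bar>v $ i - w $ i\<bar> = 1" using split d \<open>_ = 0\<close> by simp
  then consider "w $ i = v $ i + 1" | "v $ i = w $ i + 1" by linarith
  then show thesis
  proof cases
    case 1
    have "w = v + axis i 1"
      using eq 1 by (auto simp: vec_eq_iff axis_def)
    then show thesis using that v e by blast
  next
    case 2
    have "v = w + axis i 1"
      using eq 2 by (auto simp: vec_eq_iff axis_def)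
    then show thesis using that[of w i] w e by auto
  qed
qed

lemma edge_intro:
  assumes "v \<in> lattice"
  shows "{v, v + axis i 1} \<in> edges"
proof -
  have "l1norm (v - (v + axis i 1)) = 1"
    by (subst l1norm_minus_commute) simp
  moreover have "v + axis i 1 \<in> lattice"
    using assms by (simp add: lattice_def axis_def)
  ultimately show ?thesis using assms unfolding edges_def by blast
qed

lemma mem_edge_hull_iff:
  "z \<in> convex hull {v, v + axis i 1} \<longleftrightarrow>
     (\<forall>j. j \<noteq> i \<longrightarrow> z $ j = v $ j) \<and> v $ i \<le> z $ i \<and> z $ i \<le> v $ i + (1::real)"
proof
  assume "z \<in> convex hull {v, v + axis i 1}"
  then obtain s where "0 \<le> s" "s \<le> 1" "z = v + s *\<^sub>R (v + axis i 1 - v)"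
    unfolding segment_convex_hull[symmetric] in_segment
    by (auto simp: algebra_simps)
  then show "(\<forall>j. j \<noteq> i \<longrightarrow> z $ j = v $ j) \<and> v $ i \<le> z $ i \<and> z $ i \<le> v $ i + 1"
    by (auto simp: axis_def)
next
  assume *: "(\<forall>j. j \<noteq> i \<longrightarrow> z $ j = v $ j) \<and> v $ i \<le> z $ i \<and> z $ i \<le> v $ i + 1"
  have "z = (1 - (z $ i - v $ i)) *\<^sub>R v + (z $ i - v $ i) *\<^sub>R (v + axis i 1)"
    using * by (auto simp: vec_eq_iff axis_def algebra_simps)
  then show "z \<in> convex hull {v, v + axis i 1}"
    unfolding segment_convex_hull[symmetric] in_segment
    using * by (intro exI[of _ "z $ i - v $ i"]) auto
qed

lemma Ints_eqI: "x \<in> \<int> \<Longrightarrow> y \<in> \<int> \<Longrightarrow> x < y + 1 \<Longrightarrow> y < x + 1 \<Longrightarrow> x = (y::real)"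
  by (auto elim!: Ints_cases)

text \<open>Two distinct points of a segment reveal its direction as the only coordinate in which
  they differ; two unit intervals with integer ends that share two distinct points coincide. This
  makes the choice in \<open>step_time\<close> unambiguous.\<close>

lemma edge_unique:
  assumes "e \<in> edges" "e' \<in> edges" "z \<noteq> z'"
    and "z \<in> convex hull e" "z' \<in> convex hull e" "z \<in> convex hull e'" "z' \<in> convex hull e'"
  shows "e = e'"
proof -
  obtain v i where v: "v \<in> lattice" "e = {v, v + axis i 1}" using assms(1) by (rule edgesE)
  obtain w j where w: "w \<in> lattice" "e' = {w, w + axis j 1}" using assms(2) by (rule edgesE)
  obtain k where k: "z $ k \<noteq> z' $ k" using assms(3) by (auto simp: vec_eq_iff)
  note h = assms(4-7)[unfolded v(2) w(2) mem_edge_hull_iff]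
  have ki: "k = i" using h(1,2) k by (metis (no_types))
  have kj: "k = j" using h(3,4) k by (metis (no_types))
  have "v $ i = w $ i"
  proof (rule Ints_eqI)
    show "v $ i \<in> \<int>" "w $ i \<in> \<int>" using v w unfolding lattice_def by auto
    show "v $ i < w $ i + 1" "w $ i < v $ i + 1"
      using h[THEN conjunct2] k[unfolded ki] kj[unfolded ki] by auto
  qed
  then have "v $ l = w $ l" for l using h(1,3) ki kj by (cases "l = i") auto
  then have "v = w" by (simp add: vec_eq_iff)
  then show ?thesis using v w ki kj by simp
qed

section \<open>Times of steps and of paths\<close>

lemma step_time_edge:
  assumes "e \<in> edges" "z \<in> convex hull e" "z' \<in> convex hull e"
  shows "step_time b t z z' = t e * l1norm (z - z')"
proof (cases "z = z'")
  case True
  then show ?thesis by (simp add: step_time_def)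
next
  case False
  have sm: "(SOME e. e \<in> edges \<and> z \<in> convex hull e \<and> z' \<in> convex hull e) = e"
  proof (rule some_equality)
    fix e' assume "e' \<in> edges \<and> z \<in> convex hull e' \<and> z' \<in> convex hull e'"
    then show "e' = e" using edge_unique[of e' e z z'] assms False by blast
  qed (use assms in blast)
  have "\<exists>e\<in>edges. z \<in> convex hull e \<and> z' \<in> convex hull e" using assms by blast
  then show ?thesis unfolding step_time_def sm by simp
qed

lemma step_time_no_edge:
  assumes "\<And>e. e \<in> edges \<Longrightarrow> z \<in> convex hull e \<Longrightarrow> z' \<notin> convex hull e"
  shows "step_time b t z z' = b * l1norm (z - z')"
proof -
  have "\<not> (\<exists>e\<in>edges. z \<in> convex hull e \<and> z' \<in> convex hull e)" using assms by blast
  then show ?thesis unfolding step_time_def by (rule if_not_P)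
qed

lemma step_time_self [simp]: "step_time b t z z = 0"
  by (simp add: step_time_def)

text \<open>A path inside such a set uses no edge leaving it, so its time is a function of the passage
  times of the edges contained in the set.\<close>

definition edge_closed :: "(real ^ 'n) set \<Rightarrow> bool" where
  "edge_closed X \<longleftrightarrow> (\<forall>e\<in>edges. \<forall>z\<in>X. \<forall>z'\<in>X.
      z \<in> convex hull e \<longrightarrow> z' \<in> convex hull e \<longrightarrow> z \<noteq> z' \<longrightarrow> e \<subseteq> X)"

definition edges_in :: "(real ^ 'n) set \<Rightarrow> (real ^ 'n) set set" where
  "edges_in X = {e \<in> edges. e \<subseteq> X}"

text \<open>The alternative depends on the positions of \<open>z\<close> and \<open>z'\<close>
  alone, and each formula holds for all \<open>t\<close> at once. This uniformity makes path times
  affine in \<open>t\<close>, and insensitive to changes of \<open>t\<close> outside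
  \<open>edges_in X\<close>. A step with \<open>z = z'\<close> counts as free.\<close>

lemma step_time_cases:
  assumes "edge_closed X" "z \<in> X" "z' \<in> X"
  obtains (edge) e where "e \<in> edges_in X" "z \<in> convex hull e" "z' \<in> convex hull e"
      "\<And>t. step_time b t z z' = t e * l1norm (z - z')"
    | (free) "\<And>t. step_time b t z z' = b * l1norm (z - z')"
proof (cases "z = z'")
  case True
  then show ?thesis using free by simp
next
  case neq: False
  show ?thesis
  proof (cases "\<exists>e\<in>edges. z \<in> convex hull e \<and> z' \<in> convex hull e")
    case True
    then obtain e where e: "e \<in> edges" "z \<in> convex hull e" "z' \<in> convex hull e" by auto
    moreover have "e \<subseteq> X" using assms neq e unfolding edge_closed_def by blast
    ultimately have "e \<in> edges_in X" unfolding edges_in_def by blast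
    then show ?thesis using edge e(2,3) step_time_edge[OF e] by blast
  next
    case False
    then show ?thesis using free step_time_no_edge by blast
  qed
qed

lemma step_time_cong:
  assumes "edge_closed X" "z \<in> X" "z' \<in> X" "\<forall>e\<in>edges_in X. t e = t' e"
  shows "step_time b t z z' = step_time b t' z z'"
  by (rule step_time_cases[OF assms(1-3), of b]) (simp_all add: assms(4))

lemma step_time_nonneg:
  assumes "edge_closed X" "z \<in> X" "z' \<in> X" "\<forall>e\<in>edges_in X. 0 \<le> t e" "0 \<le> b"
  shows "0 \<le> step_time b t z z'"
  by (rule step_time_cases[OF assms(1-3), of b]) (simp_all add: assms(4,5))

lemma step_time_le:
  assumes "edge_closed X" "z \<in> X" "z' \<in> X" "\<forall>e\<in>edges_in X. t e \<le> c" "b \<le> c"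
  shows "step_time b t z z' \<le> c * l1norm (z - z')"
  by (rule step_time_cases[OF assms(1-3), of b]) (simp_all add: assms(4,5) mult_right_mono)

lemma path_time_singleton [simp]: "path_time b t [x] = 0"
  by (simp add: path_time_def)

lemma path_time_snoc:
  assumes "p \<noteq> []"
  shows "path_time b t (p @ [z]) = path_time b t p + step_time b t (last p) z"
proof -
  obtain n where n: "length p = Suc n" using assms by (cases p) auto
  have "(\<Sum>i<n. step_time b t ((p @ [z]) ! i) ((p @ [z]) ! Suc i)) =
      (\<Sum>i<n. step_time b t (p ! i) (p ! Suc i))"
    by (rule sum.cong) (auto simp: nth_append n)
  then show ?thesis
    unfolding path_time_def using n assms by (simp add: nth_append last_conv_nth)
qed

lemma path_time_append:
  assumes "p \<noteq> []" "q \<noteq> []" "last p = hd q"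
  shows "path_time b t (p @ tl q) = path_time b t p + path_time b t q"
  using assms(2,3)
proof (induction q rule: rev_induct)
  case (snoc w q)
  show ?case
  proof (cases "q = []")
    case False
    then have "last (p @ tl q) = last q"
      using snoc.prems by (cases q) (auto simp: last_append)
    moreover have "path_time b t (p @ tl q) = path_time b t p + path_time b t q"
      using snoc False by auto
    ultimately show ?thesis
      using False assms(1) path_time_snoc[of "p @ tl q" b t w] path_time_snoc[of q b t w] by simp
  qed simp
qed simp

definition is_path :: "(real ^ 'n) set \<Rightarrow> real ^ 'n \<Rightarrow> real ^ 'n \<Rightarrow> (real ^ 'n) list \<Rightarrow> bool" where
  "is_path X x y p \<longleftrightarrow> p \<noteq> [] \<and> set p \<subseteq> X \<and> hd p = x \<and> last p = y"

lemma passage_time_eq: "passage_time b t X x y = Inf (path_time b t ` Collect (is_path X x y))"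
  unfolding passage_time_def is_path_def by (rule arg_cong[where f = Inf]) auto

text \<open>Induction by appending a point, with the start \<open>x\<close> fixed and the current
  endpoint exposed to \<open>P\<close>, so that an invariant can speak about where the path has
  arrived.\<close>

lemma is_path_induct [consumes 1, case_names start step]:
  assumes "is_path X x y p"
    and "x \<in> X \<Longrightarrow> P x [x]"
    and "\<And>p z z'. is_path X x z p \<Longrightarrow> z' \<in> X \<Longrightarrow> z \<in> X \<Longrightarrow> P z p \<Longrightarrow> P z' (p @ [z'])"
  shows "P y p"
  using assms(1)
proof (induction p arbitrary: y rule: rev_induct)
  case (snoc w q)
  show ?case
  proof (cases "q = []")
    case True
    then show ?thesis using snoc.prems assms(2) by (auto simp: is_path_def)
  next
    case False
    then have "is_path X x (last q) q" "w = y" "y \<in> X" "last q \<in> X"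
      using snoc.prems last_in_set[of q] by (auto simp: is_path_def)
    then show ?thesis using assms(3) snoc.IH by blast
  qed
qed (simp add: is_path_def)

lemma path_time_nonneg:
  assumes "edge_closed X" "\<forall>e\<in>edges_in X. 0 \<le> t e" "0 \<le> b" "is_path X x y p"
  shows "0 \<le> path_time b t p"
  using assms(4)
proof (induction rule: is_path_induct)
  case (step p z z')
  then have "path_time b t (p @ [z']) = path_time b t p + step_time b t z z'"
    by (subst path_time_snoc) (auto simp: is_path_def)
  then show ?case using step step_time_nonneg[of X z z' t b] assms(1-3) by auto
qed simp

lemma path_time_cong:
  assumes "edge_closed X" "\<forall>e\<in>edges_in X. t e = t' e" "is_path X x y p"
  shows "path_time b t p = path_time b t' p"
  using assms(3)
proof (induction rule: is_path_induct)
  case (step p z z')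
  then show ?case using step_time_cong[of X z z' t t' b] assms(1,2)
    by (subst (1 2) path_time_snoc) (auto simp: is_path_def)
qed simp

lemma passage_time_cong:
  assumes "edge_closed X" "\<forall>e\<in>edges_in X. t e = t' e"
  shows "passage_time b t X x y = passage_time b t' X x y"
  unfolding passage_time_eq
  by (intro arg_cong[where f = Inf] image_cong) (auto intro: path_time_cong[OF assms])

lemma passage_time_le:
  assumes "edge_closed X" "\<forall>e\<in>edges_in X. 0 \<le> t e" "0 \<le> b" "is_path X x y p"
  shows "passage_time b t X x y \<le> path_time b t p"
  unfolding passage_time_eq
proof (rule cInf_lower)
  show "bdd_below (path_time b t ` Collect (is_path X x y))"
    using path_time_nonneg[OF assms(1-3)] by (intro bdd_belowI[of _ 0]) auto
qed (use assms in auto)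

lemma passage_time_ge:
  assumes "x \<in> X" "y \<in> X" "\<And>p. is_path X x y p \<Longrightarrow> c \<le> path_time b t p"
  shows "c \<le> passage_time b t X x y"
  unfolding passage_time_eq
proof (rule cInf_greatest)
  \<comment> \<open>The direct step from \<open>x\<close> to \<open>y\<close> is always a path, even
    off the edges, so the real \<open>Inf\<close> is taken over a nonempty set.\<close>
  have "is_path X x y [x, y]" using assms by (auto simp: is_path_def)
  then show "path_time b t ` Collect (is_path X x y) \<noteq> {}" by blast
qed (use assms in auto)

lemma passage_time_le_step:
  assumes "edge_closed X" "\<forall>e\<in>edges_in X. 0 \<le> t e" "0 \<le> b" "x \<in> X" "y \<in> X"
  shows "passage_time b t X x y \<le> step_time b t x y"
  using passage_time_le[OF assms(1-3), of x y "[x, y]"] assms(4,5)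
    path_time_snoc[of "[x]" b t y] by (simp add: is_path_def)

lemma passage_time_le_l1norm:
  assumes "edge_closed X" "\<forall>e\<in>edges_in X. 0 \<le> t e \<and> t e \<le> c" "0 \<le> b" "b \<le> c"
    "x \<in> X" "y \<in> X"
  shows "passage_time b t X x y \<le> c * l1norm (x - y)"
proof -
  have "passage_time b t X x y \<le> step_time b t x y"
    using assms by (intro passage_time_le_step) auto
  also have "\<dots> \<le> c * l1norm (x - y)"
    using assms by (intro step_time_le[of X]) auto
  finally show ?thesis .
qed

lemma passage_time_triangle:
  assumes "edge_closed X" "\<forall>e\<in>edges_in X. 0 \<le> t e" "0 \<le> b" "x \<in> X" "y \<in> X" "z \<in> X"
  shows "passage_time b t X x z \<le> passage_time b t X x y + passage_time b t X y z"
proof -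
  \<comment> \<open>The infimum over the second half is taken first, for a fixed first half
    \<open>p\<close>; the infimum over \<open>p\<close> follows.\<close>
  have "passage_time b t X x z - path_time b t p \<le> passage_time b t X y z" if p: "is_path X x y p" for p
  proof (rule passage_time_ge[OF assms(5,6)])
    fix q assume q: "is_path X y z q"
    have "is_path X x z (p @ tl q)"
      using p q by (cases q) (auto simp: is_path_def)
    then have "passage_time b t X x z \<le> path_time b t (p @ tl q)"
      by (intro passage_time_le assms(1-3))
    also have "\<dots> = path_time b t p + path_time b t q"
      using p q by (intro path_time_append) (auto simp: is_path_def)
    finally show "passage_time b t X x z - path_time b t p \<le> path_time b t q" by simp
  qed
  then have "passage_time b t X x z - passage_time b t X y z \<le> passage_time b t X x y"
    using assms by (intro passage_time_ge) (auto simp: algebra_simps)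
  then show ?thesis by simp
qed

lemma passage_time_antimono:
  assumes "edge_closed Y" "\<forall>e\<in>edges_in Y. 0 \<le> t e" "0 \<le> b" "X \<subseteq> Y" "x \<in> X" "y \<in> X"
  shows "passage_time b t Y x y \<le> passage_time b t X x y"
  using assms by (intro passage_time_ge passage_time_le) (auto simp: is_path_def)

section \<open>Translation by lattice vectors\<close>

lemma lattice_add: "v \<in> lattice \<Longrightarrow> w \<in> lattice \<Longrightarrow> v + w \<in> lattice"
  unfolding lattice_def by auto

lemma lattice_uminus: "v \<in> lattice \<Longrightarrow> - v \<in> lattice"
  unfolding lattice_def by auto

lemma edges_translate: "c \<in> lattice \<Longrightarrow> e \<in> edges \<Longrightarrow> (+) c ` e \<in> edges"
proof -
  assume c: "c \<in> lattice" and "e \<in> edges"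
  then obtain v i where v: "v \<in> lattice" "e = {v, v + axis i 1}" by (auto elim: edgesE)
  have "(+) c ` e = {c + v, (c + v) + axis i 1}" using v by (simp add: add.assoc)
  then show ?thesis using edge_intro[of "c + v" i] lattice_add[OF c v(1)] by simp
qed

lemma edges_translate_iff:
  assumes "c \<in> lattice"
  shows "(+) c ` e \<in> edges \<longleftrightarrow> e \<in> edges"
  using edges_translate[OF assms, of e]
    edges_translate[OF lattice_uminus[OF assms], of "(+) c ` e"]
  by (auto simp: image_image)

lemma mem_hull_translate: "c + z \<in> convex hull ((+) c ` e) \<longleftrightarrow> z \<in> convex hull (e :: (real^'n) set)"
  unfolding convex_hull_translation by auto

lemma step_time_translate:
  assumes "c \<in> lattice"
  shows "step_time b t (c + z) (c + z') = step_time b (\<lambda>e. t ((+) c ` e)) z z'"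
proof (cases "\<exists>e\<in>edges. z \<in> convex hull e \<and> z' \<in> convex hull e")
  case True
  then obtain e where e: "e \<in> edges" "z \<in> convex hull e" "z' \<in> convex hull e" by auto
  then have "step_time b t (c + z) (c + z') = t ((+) c ` e) * l1norm (c + z - (c + z'))"
    using assms by (intro step_time_edge) (simp_all only: edges_translate_iff mem_hull_translate)
  then show ?thesis using step_time_edge[OF e, of b "\<lambda>e. t ((+) c ` e)"] by simp
next
  case False
  have *: "e = (+) c ` ((+) (- c) ` e)" for e by (simp add: image_image)
  have "step_time b t (c + z) (c + z') = b * l1norm (c + z - (c + z'))"
  proof (rule step_time_no_edge)
    fix e assume "e \<in> edges" "c + z \<in> convex hull e"
    then show "c + z' \<notin> convex hull e"
      using False assms *[of e] edges_translate_iff mem_hull_translate by metis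
  qed
  then show ?thesis using False by (subst step_time_no_edge[of z z']) auto
qed

lemma path_time_translate:
  assumes "c \<in> lattice"
  shows "path_time b t (map ((+) c) p) = path_time b (\<lambda>e. t ((+) c ` e)) p"
  unfolding path_time_def
  by (auto intro!: sum.cong simp: step_time_translate[OF assms])

lemma passage_time_translate:
  assumes "c \<in> lattice"
  shows "passage_time b t ((+) c ` X) (c + x) (c + y) = passage_time b (\<lambda>e. t ((+) c ` e)) X x y"
proof -
  have "Collect (is_path ((+) c ` X) (c + x) (c + y)) = map ((+) c) ` Collect (is_path X x y)"
  proof (intro equalityI subsetI)
    fix p assume p: "p \<in> Collect (is_path ((+) c ` X) (c + x) (c + y))"
    then have "is_path X x y (map ((+) (- c)) p)"
      by (auto simp: is_path_def hd_map last_map)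
    moreover have "p = map ((+) c) (map ((+) (- c)) p)" by (simp add: comp_def)
    ultimately show "p \<in> map ((+) c) ` Collect (is_path X x y)" by blast
  qed (auto simp: is_path_def hd_map last_map intro!: imageI)
  then show ?thesis
    unfolding passage_time_eq by (simp add: image_image path_time_translate[OF assms])
qed

section \<open>Lower bound in a tiled cube\<close>

definition cube :: "real ^ 'n \<Rightarrow> real \<Rightarrow> (real ^ 'n) set" where
  "cube c s = {x. \<forall>i. c $ i \<le> x $ i \<and> x $ i \<le> c $ i + s}"

lemma Ints_less_imp_add_one_le: "x \<in> \<int> \<Longrightarrow> y \<in> \<int> \<Longrightarrow> x < y \<Longrightarrow> x + 1 \<le> (y::real)"
  by (auto elim!: Ints_cases)

text \<open>If a segment meets the cube in two distinct points, then in its own direction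
  \<open>i\<close> its unit interval overlaps \<open>[c $ i, c $ i + n]\<close> in more than one
  point; as all ends are integers, the interval lies inside. The other coordinates are constant
  along the segment.\<close>

lemma edge_closed_cube:
  assumes "c \<in> lattice"
  shows "edge_closed (cube c (real n))"
  unfolding edge_closed_def
proof (intro ballI impI)
  fix e z z'
  assume e: "e \<in> edges" and z: "z \<in> cube c (real n)" "z' \<in> cube c (real n)"
    and h: "z \<in> convex hull e" "z' \<in> convex hull e" and neq: "z \<noteq> z'"
  obtain v i where v: "v \<in> lattice" "e = {v, v + axis i 1}" using e by (rule edgesE)
  note h = h[unfolded v(2) mem_edge_hull_iff]
  have other: "z $ j = v $ j" "z' $ j = v $ j" if "j \<noteq> i" for j using h that by auto
  have ne: "z $ i \<noteq> z' $ i"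
  proof
    assume "z $ i = z' $ i"
    then have "z $ j = z' $ j" for j using other[of j] by (cases "j = i") simp_all
    then show False using neq by (simp add: vec_eq_iff)
  qed
  have zi: "c $ i \<le> z $ i" "z $ i \<le> c $ i + real n" "c $ i \<le> z' $ i" "z' $ i \<le> c $ i + real n"
    using z unfolding cube_def by auto
  have int: "v $ i \<in> \<int>" "c $ i \<in> \<int>" using v assms unfolding lattice_def by auto
  have lo: "c $ i \<le> v $ i"
  proof (rule ccontr)
    assume "\<not> c $ i \<le> v $ i"
    then have "v $ i + 1 \<le> c $ i" using int by (intro Ints_less_imp_add_one_le) auto
    then show False using h ne zi by auto
  qed
  have hi: "v $ i + 1 \<le> c $ i + real n"
  proof (rule ccontr)
    assume "\<not> v $ i + 1 \<le> c $ i + real n"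
    then have "(c $ i + real n) + 1 \<le> v $ i + 1"
      using int by (intro Ints_less_imp_add_one_le) auto
    then show False using h ne zi by auto
  qed
  have vc: "c $ j \<le> v $ j \<and> v $ j + (if j = i then 1 else 0) \<le> c $ j + real n" for j
    using z(1)[unfolded cube_def mem_Collect_eq, rule_format, of j] other(1)[of j] lo hi
    by (cases "j = i") auto
  have "c $ j \<le> v $ j \<and> v $ j \<le> c $ j + real n \<and>
      c $ j \<le> (v + axis i 1) $ j \<and> (v + axis i 1) $ j \<le> c $ j + real n" for j
    using vc[of j] by (cases "j = i") (auto simp: axis_def)
  then have "v \<in> cube c (real n)" "v + axis i 1 \<in> cube c (real n)" unfolding cube_def by blast+
  then show "e \<subseteq> cube c (real n)" unfolding v(2) by simp
qed

lemma convex_cube: "convex (cube c s)"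
proof -
  have "cube c s = cbox c (\<chi> i. c $ i + s)"
    by (auto simp: cube_def mem_box_cart)
  then show ?thesis by (simp add: convex_box)
qed

lemma cube_translate: "(+) v ` cube c s = cube (v + c) s"
proof (intro equalityI subsetI)
  fix x assume "x \<in> cube (v + c) s"
  then have "x = v + (x - v)" "x - v \<in> cube c s" by (auto simp: cube_def algebra_simps)
  then show "x \<in> (+) v ` cube c s" by blast
qed (auto simp: cube_def algebra_simps)

lemma mem_cube_translate: "v + x \<in> cube (v + c) s \<longleftrightarrow> x \<in> cube c s"
  by (auto simp: cube_def)

lemma is_norm_commute:
  assumes "is_norm g"
  shows "g (x - y) = g (y - x)"
proof -
  have "g ((-1) *\<^sub>R (y - x)) = \<bar>-1\<bar> * g (y - x)" using assms unfolding is_norm_def by blast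
  then show ?thesis by simp
qed

lemma is_norm_triangle_via:
  assumes "is_norm g"
  shows "g (x - z) \<le> g (x - y) + g (y - z)"
proof -
  have "g ((x - y) + (y - z)) \<le> g (x - y) + g (y - z)" using assms unfolding is_norm_def by blast
  then show ?thesis by simp
qed

text \<open>The invariant along a path started at \<open>x\<close> records the core \<open>Q\<close> visited last, with its
  first and last points \<open>u\<close>, \<open>w\<close> of that visit: excursions of the path that come back to \<open>Q\<close>
  are replaced by shortcuts through \<open>Q\<close>.  The additive error \<open>D\<close> made in \<open>Q\<close> is paid for by the
  gap that is crossed on the way to the next core.\<close>

lemma passage_time_lower_bound:
  assumes X: "edge_closed X" and t: "\<forall>e\<in>edges_in X. 0 \<le> t e \<and> t e \<le> b"
    and Q: "\<And>Q. Q \<in> \<Q> \<Longrightarrow> edge_closed Q \<and> convex Q \<and> Q \<subseteq> X"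
    and g: "is_norm g" "\<And>x. g x \<le> b * l1norm x"
    and core: "\<And>Q u w. Q \<in> \<Q> \<Longrightarrow> u \<in> Q \<Longrightarrow> w \<in> Q \<Longrightarrow> g (u - w) - D \<le> passage_time b t Q u w"
    and D: "0 \<le> D" and b: "0 \<le> b" and lam: "0 \<le> lam" "lam \<le> 1" "lam * b \<le> \<beta>" "\<beta> \<le> b"
    and gap: "\<And>Q Q' w z. Q \<in> \<Q> \<Longrightarrow> Q' \<in> \<Q> \<Longrightarrow> Q \<noteq> Q' \<Longrightarrow> w \<in> Q \<Longrightarrow> z \<in> Q' \<Longrightarrow>
        lam * g (w - z) + D \<le> \<beta> * l1norm (w - z)"
    and corridor: "\<And>e. e \<in> edges_in X \<Longrightarrow> (\<And>Q. Q \<in> \<Q> \<Longrightarrow> \<not> e \<subseteq> Q) \<Longrightarrow> \<beta> \<le> t e"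
    and x: "Q0 \<in> \<Q>" "x \<in> Q0" and y: "y \<in> X"
  shows "lam * g (x - y) - D \<le> passage_time b t X x y"
proof (rule passage_time_ge)
  show "x \<in> X" using x Q by blast
  have b': "0 \<le> \<beta>" using lam b mult_nonneg_nonneg[of lam b] by linarith
  have lamg: "lam * g z \<le> \<beta> * l1norm z" for z
  proof -
    have "lam * g z \<le> lam * (b * l1norm z)" using g(2) lam(1) by (rule mult_left_mono)
    also have "\<dots> \<le> \<beta> * l1norm z" using mult_right_mono[OF lam(3), of "l1norm z"] by (simp add: mult.assoc)
    finally show ?thesis .
  qed
  have lamtri: "lam * g (u - v) \<le> lam * g (u - w) + lam * g (w - v)" for u v w
    using mult_left_mono[OF is_norm_triangle_via[OF g(1)] lam(1), of u v w] by (simp add: distrib_left)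
  \<comment> \<open>The error is left unscaled, by \<open>lam * D \<le> D\<close>, to match the full
    \<open>D\<close> that \<open>gap\<close> gives back.\<close>
  have lamcore: "lam * g (u - w) - D \<le> lam * passage_time b t Q u w"
    if "Q \<in> \<Q>" "u \<in> Q" "w \<in> Q" for Q u w
  proof -
    have "lam * (g (u - w) - D) \<le> lam * passage_time b t Q u w"
      using core[OF that] lam(1) by (rule mult_left_mono)
    moreover have "lam * D \<le> D" using mult_right_mono[OF lam(2) D] by simp
    ultimately show ?thesis by (simp add: right_diff_distrib)
  qed
  have tQ: "\<forall>e\<in>edges_in Q. 0 \<le> t e \<and> t e \<le> b" "\<forall>e\<in>edges_in Q. 0 \<le> t e" if "Q \<in> \<Q>" for Q
    using t Q[OF that] unfolding edges_in_def by blast+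
  have g0: "g 0 = 0" using g(1) unfolding is_norm_def by blast
  fix p assume "is_path X x y p"
  \<comment> \<open>The three terms account for the journey up to the current visit, the visit
    itself, and what was spent since \<open>w\<close>. Keeping the actual passage time in
    \<open>Q\<close>, rather than \<open>g (u - w) - D\<close>, avoids losing \<open>D\<close> at
    each return to the same core.\<close>
  then have "\<exists>Q\<in>\<Q>. \<exists>u\<in>Q. \<exists>w\<in>Q.
      lam * g (x - u) + lam * passage_time b t Q u w + \<beta> * l1norm (w - y) \<le> path_time b t p"
  proof (induction rule: is_path_induct)
    case start
    have "passage_time b t Q0 x x \<le> step_time b t x x"
      using Q[OF x(1)] tQ[OF x(1)] b x by (intro passage_time_le_step) auto
    then have "passage_time b t Q0 x x \<le> 0" by simp
    then have "lam * passage_time b t Q0 x x \<le> 0" using lam(1) by (rule mult_nonneg_nonpos[rotated])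
    then show ?case using x g0 by (intro bexI[of _ Q0] bexI[of _ x]) auto
  next
    case (step p z z')
    obtain Q1 u w where Q1: "Q1 \<in> \<Q>" "u \<in> Q1" "w \<in> Q1"
      and le: "lam * g (x - u) + lam * passage_time b t Q1 u w + \<beta> * l1norm (w - z) \<le> path_time b t p"
      using step.IH by blast
    have snoc: "path_time b t (p @ [z']) = path_time b t p + step_time b t z z'"
      using step.hyps by (subst path_time_snoc) (auto simp: is_path_def)
    \<comment> \<open>A step that costs at least \<open>\<beta>\<close> per unit length is absorbed
      by the last term, with the same core and points.\<close>
    have stay: ?case if "\<beta> * l1norm (z - z') \<le> step_time b t z z'"
    proof -
      have "\<beta> * l1norm (w - z') \<le> \<beta> * l1norm (w - z) + \<beta> * l1norm (z - z')"
        using mult_left_mono[OF l1norm_triangle_via b', of w z' z] by (simp add: distrib_left)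
      then show ?thesis using le that snoc Q1
        by (intro bexI[of _ Q1] bexI[of _ u] bexI[of _ w]) auto
    qed
    show ?case
    proof (rule step_time_cases[OF X step.hyps(3,2), of b])
      assume "\<And>t. step_time b t z z' = b * l1norm (z - z')"
      then show ?thesis using lam(4) by (intro stay) (simp add: mult_right_mono)
    next
      fix e assume e: "e \<in> edges_in X" "z \<in> convex hull e" "z' \<in> convex hull e"
        and st: "\<And>t. step_time b t z z' = t e * l1norm (z - z')"
      show ?thesis
      proof (cases "\<exists>Q\<in>\<Q>. e \<subseteq> Q")
        case False
        then have "\<beta> \<le> t e" using corridor e by blast
        then show ?thesis using st by (intro stay) (simp add: mult_right_mono)
      next
        case True
        then obtain Q2 where Q2: "Q2 \<in> \<Q>" "e \<subseteq> Q2" by blast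
        then have "convex hull e \<subseteq> Q2" using Q by (simp add: hull_minimal)
        then have zQ: "z \<in> Q2" "z' \<in> Q2" using e by auto
        have T: "passage_time b t Q2 z z' \<le> step_time b t z z'"
          using Q[OF Q2(1)] tQ[OF Q2(1)] b zQ by (intro passage_time_le_step) auto
        have st0: "0 \<le> step_time b t z z'"
          using step_time_nonneg[OF X step.hyps(3,2) _ b, of t] t by blast
        have lamst: "lam * step_time b t z z' \<le> step_time b t z z'"
          using mult_right_mono[OF lam(2) st0] by simp
        have lamT: "lam * passage_time b t Q2 z z' \<le> step_time b t z z'"
          using mult_left_mono[OF T lam(1)] lamst by linarith
        show ?thesis
        proof (cases "Q1 = Q2")
          case True
          \<comment> \<open>Back in the same core, the excursion from \<open>w\<close> to
            \<open>z\<close> is replaced by a direct step inside it, at a price of at most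
            \<open>b\<close> per unit length; after scaling by \<open>lam\<close> this is covered by
            \<open>\<beta>\<close>, as \<open>lam * b \<le> \<beta>\<close>.\<close>
          have "passage_time b t Q2 u z' \<le> passage_time b t Q2 u w + passage_time b t Q2 w z'"
            using Q1 Q2 Q[OF Q2(1)] tQ[OF Q2(1)] b zQ True by (intro passage_time_triangle) auto
          moreover have "passage_time b t Q2 w z' \<le> passage_time b t Q2 w z + passage_time b t Q2 z z'"
            using Q1 Q2 Q[OF Q2(1)] tQ[OF Q2(1)] b zQ True by (intro passage_time_triangle) auto
          moreover have "passage_time b t Q2 w z \<le> b * l1norm (w - z)"
            using Q1 Q2 Q[OF Q2(1)] tQ[OF Q2(1)] b zQ True by (intro passage_time_le_l1norm) auto
          ultimately have "passage_time b t Q2 u z' \<le>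
              passage_time b t Q2 u w + b * l1norm (w - z) + passage_time b t Q2 z z'" by linarith
          from mult_left_mono[OF this lam(1)]
          have "lam * passage_time b t Q2 u z' \<le>
              lam * passage_time b t Q2 u w + (lam * b) * l1norm (w - z) + lam * passage_time b t Q2 z z'"
            by (simp add: algebra_simps)
          then have "lam * passage_time b t Q2 u z' \<le>
              lam * passage_time b t Q2 u w + \<beta> * l1norm (w - z) + step_time b t z z'"
            using lamT mult_right_mono[OF lam(3), of "l1norm (w - z)"] by (simp add: l1norm_nonneg)
          then show ?thesis using le snoc Q1 Q2 zQ True
            by (intro bexI[of _ Q2] bexI[of _ u] bexI[of _ z']) auto
        next
          case False
          \<comment> \<open>A new core is entered at \<open>z\<close>. The finished visit is
            converted to \<open>lam * g\<close> with its loss \<open>D\<close>, and the gap crossed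
            between \<open>w\<close> and \<open>z\<close> gives the \<open>D\<close> back, so the
            next visit starts without debt.\<close>
          have "lam * g (x - z) \<le> path_time b t p"
            using le lamcore[OF Q1] gap[OF Q1(1) Q2(1) False Q1(3) zQ(1)]
              lamtri[of x z u] lamtri[of u z w] by linarith
          then show ?thesis using lamT snoc Q2 zQ
            by (intro bexI[of _ Q2] bexI[of _ z] bexI[of _ z']) auto
        qed
      qed
    qed
  qed
  then obtain Q1 u w where Q1: "Q1 \<in> \<Q>" "u \<in> Q1" "w \<in> Q1"
    and le: "lam * g (x - u) + lam * passage_time b t Q1 u w + \<beta> * l1norm (w - y) \<le> path_time b t p"
    by blast
  \<comment> \<open>Only the core visited last leaves a \<open>D\<close> unpaid.\<close>
  then show "lam * g (x - y) - D \<le> path_time b t p"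
    using lamcore[OF Q1] lamtri[of x y u] lamtri[of u y w] lamg[of "w - y"] by linarith
qed (fact y)

section \<open>Upper bound in a tiled cube\<close>

definition corner :: "nat \<Rightarrow> ('n::finite \<Rightarrow> int) \<Rightarrow> real ^ 'n" where
  "corner L k = (\<chi> i. real L * of_int (k i))"

lemma corner_nth [simp]: "corner L k $ i = real L * of_int (k i)"
  by (simp add: corner_def)

lemma corner_lattice: "corner L k \<in> lattice"
  unfolding lattice_def by simp

lemma is_norm_scale: "is_norm g \<Longrightarrow> g (c *\<^sub>R x) = \<bar>c\<bar> * g x"
  unfolding is_norm_def by blast

text \<open>The straight line is drawn in the space where the gaps of width \<open>m\<close> between the cores are
  collapsed; it is cut where it passes from one core to the next, and the gap is jumped there.\<close>

lemma passage_time_upper_bound: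
  fixes k k' :: "'n::finite \<Rightarrow> int" and p p' :: "real ^ 'n" and n m :: nat
  assumes X: "edge_closed X" and t: "\<forall>e\<in>edges_in X. 0 \<le> t e \<and> t e \<le> b" and b: "0 \<le> b"
    and g: "is_norm g" and D: "0 \<le> D"
    and sub: "\<And>k. (\<And>i. 0 \<le> k i \<and> k i < K) \<Longrightarrow> cube (corner (n + m) k) (real n) \<subseteq> X"
    and core: "\<And>k u v. (\<And>i. 0 \<le> k i \<and> k i < K) \<Longrightarrow>
       u \<in> cube (corner (n + m) k) (real n) \<Longrightarrow> v \<in> cube (corner (n + m) k) (real n) \<Longrightarrow>
       passage_time b t X u v \<le> g (u - v) + D"
    and k: "\<And>i. 0 \<le> k i \<and> k i < K" and k': "\<And>i. 0 \<le> k' i \<and> k' i < K"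
    and p: "p \<in> cube 0 (real n)" and p': "p' \<in> cube 0 (real n)"
  shows "passage_time b t X (corner (n + m) k + p) (corner (n + m) k' + p') \<le>
     g (corner n k + p - (corner n k' + p')) + (D + b * real m) * of_int (\<Sum>i\<in>UNIV. \<bar>k i - k' i\<bar>) + D"
  using k p
proof (induction "nat (\<Sum>i\<in>UNIV. \<bar>k i - k' i\<bar>)" arbitrary: k p rule: less_induct)
  case less
  have inQ: "corner (n + m) k + p \<in> cube (corner (n + m) k) (real n)" if "p \<in> cube 0 (real n)"
    for k :: "'n \<Rightarrow> int" and p
    using that mem_cube_translate[of "corner (n + m) k" p 0 "real n"] by simp
  show ?case
  proof (cases "k = k'")
    case True
    have "passage_time b t X (corner (n + m) k + p) (corner (n + m) k + p') \<le>
        g (corner (n + m) k + p - (corner (n + m) k + p')) + D"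
      using less.prems p' by (intro core[of k] inQ) auto
    then show ?thesis using True by simp
  next
    case False
    \<comment> \<open>\<open>q\<close> is, up to sign, the argument of \<open>g\<close> in the
      claim: the displacement still to go in the collapsed space. In each coordinate of
      \<open>I\<close>, where the cells differ, \<open>f i\<close> is the face of the current core
      towards the target and \<open>s i\<close> the parameter at which the line reaches it.\<close>
    define q where "q = corner n k' + p' - (corner n k + p)"
    define I where "I = {i. k i \<noteq> k' i}"
    define f where "f i = (if k i < k' i then real n else 0)" for i
    define s where "s i = (f i - p $ i) / q $ i" for i
    have pb: "0 \<le> p $ i" "p $ i \<le> real n" "0 \<le> p' $ i" "p' $ i \<le> real n" for i
      using less.prems(2) p' unfolding cube_def by auto
    have q: "q $ i = real n * of_int (k' i - k i) + p' $ i - p $ i" for i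
      unfolding q_def by (simp add: algebra_simps)
    have up: "real n - p $ i \<le> q $ i" if "k i < k' i" for i
    proof -
      have "real n * 1 \<le> real n * of_int (k' i - k i)"
        using that by (intro mult_left_mono) linarith+
      then show ?thesis using pb[of i] q[of i] by linarith
    qed
    have down: "q $ i \<le> - p $ i" if "k' i < k i" for i
    proof -
      have "real n * of_int (k' i - k i) \<le> real n * (-1)"
        using that by (intro mult_left_mono) linarith+
      then show ?thesis using pb[of i] q[of i] by linarith
    qed
    \<comment> \<open>If \<open>q $ i = 0\<close>, then \<open>up\<close> or \<open>down\<close>
      forces \<open>f i = p $ i\<close>, so the value of a division by zero does no harm.\<close>
    have sq: "s i * q $ i = f i - p $ i" if "i \<in> I" for i
      using that up[of i] down[of i] pb[of i] unfolding s_def f_def I_def by (auto split: if_splits)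
    have s01: "0 \<le> s i \<and> s i \<le> 1" if "i \<in> I" for i
    proof (cases "k i < k' i")
      case True
      then show ?thesis using up[OF True] pb[of i] unfolding s_def f_def
        by (auto simp: divide_simps)
    next
      case False
      then have "k' i < k i" using that I_def by auto
      then show ?thesis using down[of i] pb[of i] False unfolding s_def f_def
        by (auto simp: divide_simps)
    qed
    have "I \<noteq> {}" using False unfolding I_def by auto
    then have "Min (s ` I) \<in> s ` I" by (intro Min_in) auto
    then obtain i0 where i0: "i0 \<in> I" "s i0 = Min (s ` I)" by auto
    have smin: "s i0 \<le> s i" if "i \<in> I" for i using that i0(2) by (simp add: Min_le)
    \<comment> \<open>The face reached first is in direction \<open>i0\<close>; the line leaves the
      core there, at local position \<open>p1\<close>. Seen from the neighbouring cell
      \<open>k1\<close>, the same collapsed point has local position \<open>p2\<close>, on the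
      opposite face.\<close>
    define p1 where "p1 = p + s i0 *\<^sub>R q"
    define \<sigma> where "\<sigma> = sgn (k' i0 - k i0)"
    define k1 where "k1 = k(i0 := k i0 + \<sigma>)"
    define p2 where "p2 = p1 - axis i0 (real n * of_int \<sigma>)"
    have p1i: "p1 $ i = p $ i + s i0 * q $ i" for i unfolding p1_def by simp
    \<comment> \<open>Outside \<open>I\<close> the local coordinate moves between
      \<open>p $ i\<close> and \<open>p' $ i\<close>; inside \<open>I\<close> it has not passed its
      face, by minimality of \<open>s i0\<close>.\<close>
    have p1b: "0 \<le> p1 $ i \<and> p1 $ i \<le> real n" for i
    proof (cases "i \<in> I")
      case False
      then have "p1 $ i = (1 - s i0) * p $ i + s i0 * p' $ i"
        unfolding p1i q I_def by (simp add: algebra_simps)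
      moreover have "(1 - s i0) * p $ i + s i0 * p' $ i \<le> (1 - s i0) * real n + s i0 * real n"
        using s01[OF i0(1)] pb by (intro add_mono mult_left_mono) auto
      moreover have "0 \<le> (1 - s i0) * p $ i + s i0 * p' $ i"
        using s01[OF i0(1)] pb by (intro add_nonneg_nonneg mult_nonneg_nonneg) auto
      ultimately show ?thesis by (simp add: algebra_simps)
    next
      case True
      show ?thesis
      proof (cases "k i < k' i")
        case up': True
        have "0 \<le> q $ i" using up[OF up'] pb[of i] by linarith
        then have "0 \<le> s i0 * q $ i" "s i0 * q $ i \<le> s i * q $ i"
          using s01[OF i0(1)] smin[OF True] by (auto intro: mult_right_mono)
        then show ?thesis using sq[OF True] pb[of i] up' unfolding p1i f_def by auto
      next
        case False
        then have "k' i < k i" using True I_def by auto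
        then have "q $ i \<le> 0" using down[of i] pb[of i] by linarith
        then have "s i0 * q $ i \<le> 0" "s i * q $ i \<le> s i0 * q $ i"
          using s01[OF i0(1)] smin[OF True] by (auto intro: mult_right_mono_neg mult_nonneg_nonpos)
        then show ?thesis using sq[OF True] pb[of i] False unfolding p1i f_def by auto
      qed
    qed
    then have p1: "p1 \<in> cube 0 (real n)" unfolding cube_def by simp
    have p1i0: "p1 $ i0 = f i0" using sq[OF i0(1)] unfolding p1i by simp
    have \<sigma>: "(\<sigma> = 1 \<and> k i0 < k' i0) \<or> (\<sigma> = -1 \<and> k' i0 < k i0)"
      using i0(1) unfolding \<sigma>_def I_def by (auto simp: sgn_if)
    have "0 \<le> p2 $ i \<and> p2 $ i \<le> real n" for i
    proof (cases "i = i0")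
      case True
      then show ?thesis using p1i0 \<sigma> unfolding p2_def f_def by (auto simp: axis_def)
    next
      case False
      then show ?thesis using p1b[of i] unfolding p2_def by (simp add: axis_def)
    qed
    then have p2: "p2 \<in> cube 0 (real n)" unfolding cube_def by simp
    have k1: "0 \<le> k1 i \<and> k1 i < K" for i
      using less.prems(1)[of i] k'[of i] \<sigma> unfolding k1_def by auto
    have sum_k: "(\<Sum>i\<in>UNIV. \<bar>k i - k' i\<bar>) = \<bar>k i0 - k' i0\<bar> + (\<Sum>i\<in>UNIV - {i0}. \<bar>k i - k' i\<bar>)"
      by (rule sum.remove) auto
    have sum_k1: "(\<Sum>i\<in>UNIV. \<bar>k1 i - k' i\<bar>) = \<bar>k1 i0 - k' i0\<bar> + (\<Sum>i\<in>UNIV - {i0}. \<bar>k i - k' i\<bar>)"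
      by (subst sum.remove[of UNIV i0]) (auto simp: k1_def)
    have sums: "(\<Sum>i\<in>UNIV. \<bar>k1 i - k' i\<bar>) = (\<Sum>i\<in>UNIV. \<bar>k i - k' i\<bar>) - 1"
      unfolding sum_k sum_k1 using \<sigma> by (auto simp: k1_def)
    have "0 \<le> (\<Sum>i\<in>UNIV. \<bar>k1 i - k' i\<bar>)" by (rule sum_nonneg) simp
    then have dec: "nat (\<Sum>i\<in>UNIV. \<bar>k1 i - k' i\<bar>) < nat (\<Sum>i\<in>UNIV. \<bar>k i - k' i\<bar>)"
      using sums by linarith
    let ?A = "corner (n + m) k + p" and ?A1 = "corner (n + m) k + p1"
      and ?A2 = "corner (n + m) k1 + p2" and ?B = "corner (n + m) k' + p'"
    have in_X: "?A \<in> X" "?A1 \<in> X" "?A2 \<in> X" "?B \<in> X"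
      using sub[of k] sub[of k1] sub[of k'] inQ less.prems p1 p2 p' k1 k' by blast+
    have gscale: "g (c *\<^sub>R q) = \<bar>c\<bar> * g q" for c using is_norm_scale[OF g] .
    \<comment> \<open>One round costs \<open>s i0 * g q + D\<close> in the core and
      \<open>b * m\<close> for the jump; then \<open>(1 - s i0) * q\<close> is left and the index
      distance has dropped by one. The values of \<open>g\<close> add up exactly because all pieces
      are multiples of \<open>q\<close>.\<close>
    have "passage_time b t X ?A ?A1 \<le> g (?A - ?A1) + D"
      using less.prems p1 by (intro core[of k] inQ) auto
    also have "?A - ?A1 = (- s i0) *\<^sub>R q" unfolding p1_def by simp
    finally have T1: "passage_time b t X ?A ?A1 \<le> s i0 * g q + D"
      unfolding gscale using s01[OF i0(1)] by simp
    have "?A2 - ?A1 = axis i0 (real m * of_int \<sigma>)"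
      unfolding p2_def k1_def by (auto simp: vec_eq_iff axis_def algebra_simps)
    then have "l1norm (?A1 - ?A2) = real m"
      using \<sigma> by (subst l1norm_minus_commute) auto
    then have T2: "passage_time b t X ?A1 ?A2 \<le> b * real m"
      using passage_time_le_l1norm[OF X t b order_refl in_X(2,3)] by simp
    have "corner n k1 + p2 - (corner n k' + p') = (s i0 - 1) *\<^sub>R q"
      unfolding p2_def p1_def k1_def q_def by (auto simp: vec_eq_iff axis_def algebra_simps)
    then have "g (corner n k1 + p2 - (corner n k' + p')) = (1 - s i0) * g q"
      using gscale s01[OF i0(1)] by simp
    then have T3: "passage_time b t X ?A2 ?B \<le> (1 - s i0) * g q
        + (D + b * real m) * (of_int (\<Sum>i\<in>UNIV. \<bar>k i - k' i\<bar>) - 1) + D"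
      using less.hyps[OF dec k1 p2] unfolding sums by simp
    have t0: "\<forall>e\<in>edges_in X. 0 \<le> t e" using t by blast
    have "passage_time b t X ?A ?B \<le> passage_time b t X ?A ?A1 + passage_time b t X ?A1 ?B"
      by (rule passage_time_triangle[OF X t0 b in_X(1,2,4)])
    also have "passage_time b t X ?A1 ?B \<le> passage_time b t X ?A1 ?A2 + passage_time b t X ?A2 ?B"
      by (rule passage_time_triangle[OF X t0 b in_X(2,3,4)])
    finally have "passage_time b t X ?A ?B \<le> g q + (D + b * real m) * of_int (\<Sum>i\<in>UNIV. \<bar>k i - k' i\<bar>) + D"
      using T1 T2 T3 by (simp add: algebra_simps)
    moreover have "g (corner n k + p - (corner n k' + p')) = g q"
      unfolding q_def by (rule is_norm_commute[OF g])
    ultimately show ?thesis by simp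
  qed
qed

section \<open>Geometry of the tiling and the resulting deviation bound\<close>

lemma nearby_core_point:
  fixes x :: "real ^ 'n"
  assumes L: "L = n + m" "0 < L" and K: "K = N div L" "0 < K" and x: "x \<in> cube 0 (real N)"
  obtains k p where "\<And>i. 0 \<le> k i \<and> k i < int K" "p \<in> cube 0 (real n)"
    "l1norm (x - (corner L k + p)) \<le> real CARD('n) * (2 * real L)"
proof -
  define k where "k i = min (int K - 1) \<lfloor>x $ i / real L\<rfloor>" for i
  define p :: "real ^ 'n" where "p = (\<chi> i. min (real n) (x $ i - real L * of_int (k i)))"
  have xb: "0 \<le> x $ i" "x $ i \<le> real N" for i using x unfolding cube_def by auto
  have lo: "real L * of_int (k i) \<le> x $ i" for i
  proof -
    have "real_of_int (k i) \<le> x $ i / real L" unfolding k_def by linarith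
    then show ?thesis using L(2) by (simp add: field_simps)
  qed
  \<comment> \<open>The factor 2 comes from indices clipped at \<open>K - 1\<close>: beyond the last
    full cell an incomplete period, shorter than \<open>L\<close>, remains at the far end of the
    cube.\<close>
  have hi: "x $ i \<le> real L * of_int (k i) + 2 * real L" for i
  proof (cases "k i = int K - 1")
    case True
    have "N < L * K + L" unfolding K(1) using L(2) by (metis dividend_less_times_div mult.commute add.commute)
    then have "real N < real L * real K + real L" by (metis of_nat_add of_nat_less_iff of_nat_mult)
    moreover have "real K = of_int (k i) + 1" using True by simp
    ultimately show ?thesis using xb[of i] by (simp add: algebra_simps)
  next
    case False
    then have "x $ i / real L \<le> of_int (k i) + 1" unfolding k_def by linarith
    then show ?thesis using L(2) by (simp add: field_simps)
  qed
  show thesis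
  proof (rule that)
    show "0 \<le> k i \<and> k i < int K" for i
      using xb[of i] K(2) unfolding k_def by auto
    show "p \<in> cube 0 (real n)" using lo unfolding p_def cube_def by auto
    show "l1norm (x - (corner L k + p)) \<le> real CARD('n) * (2 * real L)"
    proof (rule l1norm_le_card)
      fix i
      show "\<bar>(x - (corner L k + p)) $ i\<bar> \<le> 2 * real L"
        using lo[of i] hi[of i] by (auto simp: p_def min_def)
    qed
  qed
qed

lemma core_subset:
  assumes L: "L = n + m" and K: "K = N div L" and k: "\<And>i. 0 \<le> k i \<and> k i < int K"
  shows "cube (corner L k) (real n) \<subseteq> cube 0 (real N)"
proof
  fix x assume x: "x \<in> cube (corner L k) (real n)"
  have "0 \<le> x $ i \<and> x $ i \<le> real N" for i
  proof -
    have "real L * of_int (k i) \<le> real L * (real K - 1)"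
      using k[of i] by (intro mult_left_mono) linarith+
    moreover have "real L * real K \<le> real N"
      unfolding K by (metis of_nat_le_iff of_nat_mult times_div_less_eq_dividend)
    moreover have "0 \<le> real L * of_int (k i)" using k[of i] by simp
    moreover have "real L * of_int (k i) \<le> x $ i" "x $ i \<le> real L * of_int (k i) + real n"
      using x unfolding cube_def by auto
    ultimately show ?thesis using L by (auto simp: algebra_simps)
  qed
  then show "x \<in> cube 0 (real N)" unfolding cube_def by simp
qed

text \<open>Corners with distinct indices differ by at least \<open>L\<close> in some coordinate,
  and the core takes up \<open>n\<close> of it.\<close>

lemma core_gap:
  assumes "L = n + m" "k \<noteq> k'" "w \<in> cube (corner L k) (real n)" "z \<in> cube (corner L k') (real n)"
  shows "real m \<le> l1norm (w - z)"
proof -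
  obtain i where i: "k i \<noteq> k' i" using assms(2) by auto
  have wz: "real L * of_int (k i) \<le> w $ i" "w $ i \<le> real L * of_int (k i) + real n"
    "real L * of_int (k' i) \<le> z $ i" "z $ i \<le> real L * of_int (k' i) + real n"
    using assms(3,4) unfolding cube_def by auto
  have "real m \<le> \<bar>w $ i - z $ i\<bar>"
  proof (cases "k i < k' i")
    case True
    then have "real L * (of_int (k i) + 1) \<le> real L * of_int (k' i)"
      by (intro mult_left_mono) linarith+
    then show ?thesis using wz assms(1) by (simp add: algebra_simps)
  next
    case False
    then have "real L * (of_int (k' i) + 1) \<le> real L * of_int (k i)"
      using i by (intro mult_left_mono) linarith+
    then show ?thesis using wz assms(1) by (simp add: algebra_simps)
  qed
  then show ?thesis using abs_component_le_l1norm[of "w - z" i] by simp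
qed

text \<open>Origin of the error terms: \<open>(1 - lam) * b * d * N\<close> is the price of having
  \<open>lam * g\<close> instead of \<open>g\<close>; a line crosses at most \<open>d * K\<close>
  gaps, each costing \<open>D + b * m\<close> for core and jump and another \<open>b * m\<close> for
  undoing the collapse; \<open>8 * b * d * L\<close> moves both endpoints into cores, over an l1
  distance of at most \<open>2 * d * L\<close> each, once for \<open>g\<close> and once for the
  passage time.\<close>

lemma tiling_deviation:
  fixes g :: "real ^ 'n \<Rightarrow> real" and n m N K L :: nat
  assumes L: "L = n + m" "0 < L" and K: "K = N div L" "0 < K"
    and t: "\<forall>e\<in>edges_in (cube 0 (real N)). 0 \<le> t e \<and> t e \<le> b" and b: "0 \<le> b"
    and g: "is_norm g" "\<And>x. g x \<le> b * l1norm x"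
    and core: "\<And>k u v. (\<And>i. 0 \<le> k i \<and> k i < int K) \<Longrightarrow>
       u \<in> cube (corner L k) (real n) \<Longrightarrow> v \<in> cube (corner L k) (real n) \<Longrightarrow>
       \<bar>g (u - v) - passage_time b t (cube (corner L k) (real n)) u v\<bar> \<le> D"
    and D: "0 \<le> D" and lam: "0 \<le> lam" "lam \<le> 1" "lam * b \<le> \<beta>" "\<beta> \<le> b" "D \<le> (\<beta> - lam * b) * real m"
    and corridor: "\<And>e. e \<in> edges_in (cube 0 (real N)) \<Longrightarrow>
       (\<And>k. (\<And>i. 0 \<le> k i \<and> k i < int K) \<Longrightarrow> \<not> e \<subseteq> cube (corner L k) (real n)) \<Longrightarrow> \<beta> \<le> t e"
    and x: "x \<in> cube 0 (real N)" and y: "y \<in> cube 0 (real N)"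
  defines "d \<equiv> real CARD('n)"
  shows "\<bar>g (x - y) - passage_time b t (cube 0 (real N)) x y\<bar> \<le>
     (1 - lam) * b * d * real N + (D + 2 * b * real m) * d * real K + D + 8 * b * d * real L"
proof -
  define X :: "(real ^ 'n) set" where "X = cube 0 (real N)"
  define \<Q> :: "(real ^ 'n) set set" where "\<Q> = {cube (corner L k) (real n) | k. \<forall>i. 0 \<le> k i \<and> k i < int K}"
  have X: "edge_closed X" unfolding X_def by (rule edge_closed_cube) (simp add: lattice_def)
  have t: "\<forall>e\<in>edges_in X. 0 \<le> t e \<and> t e \<le> b" using t unfolding X_def .
  then have t0: "\<forall>e\<in>edges_in X. 0 \<le> t e" by blast
  have sub: "cube (corner L k) (real n) \<subseteq> X" if "\<And>i. 0 \<le> k i \<and> k i < int K" for k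
    unfolding X_def using core_subset[OF L(1) K(1) that] .
  have inQ: "corner L k + p \<in> cube (corner L k) (real n)" if "p \<in> cube 0 (real n)"
    for k :: "'n \<Rightarrow> int" and p
    using that mem_cube_translate[of "corner L k" p 0 "real n"] by simp
  obtain k p where k: "\<And>i. 0 \<le> k i \<and> k i < int K" and p: "p \<in> cube 0 (real n)"
    and xd: "l1norm (x - (corner L k + p)) \<le> d * (2 * real L)"
    unfolding d_def using nearby_core_point[OF L K x] by metis
  obtain k' p' where k': "\<And>i. 0 \<le> k' i \<and> k' i < int K" and p': "p' \<in> cube 0 (real n)"
    and yd: "l1norm (y - (corner L k' + p')) \<le> d * (2 * real L)"
    unfolding d_def using nearby_core_point[OF L K y] by metis
  define x' where "x' = corner L k + p"
  define y' where "y' = corner L k' + p'"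
  have x'Q: "x' \<in> cube (corner L k) (real n)" and y'Q: "y' \<in> cube (corner L k') (real n)"
    unfolding x'_def y'_def using inQ p p' by auto
  have x'X: "x' \<in> X" and y'X: "y' \<in> X" using x'Q y'Q sub k k' by blast+
  have xX: "x \<in> X" and yX: "y \<in> X" using x y unfolding X_def by auto
  define T where "T = passage_time b t X"
  have tri: "T u w \<le> T u v + T v w" if "u \<in> X" "v \<in> X" "w \<in> X" for u v w
    unfolding T_def using that by (intro passage_time_triangle X t0 b)
  have Tl: "T u v \<le> b * l1norm (u - v)" if "u \<in> X" "v \<in> X" for u v
    unfolding T_def using that by (intro passage_time_le_l1norm X t b order_refl)
  define \<rho> where "\<rho> = b * (d * (2 * real L))"
  have dist: "b * l1norm (x - x') \<le> \<rho>" "b * l1norm (x' - x) \<le> \<rho>"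
     "b * l1norm (y - y') \<le> \<rho>" "b * l1norm (y' - y) \<le> \<rho>"
    unfolding \<rho>_def using xd yd b
    by (auto simp: x'_def y'_def l1norm_minus_commute[of "_ + _"] intro!: mult_left_mono)
  have T_T: "T x y \<le> T x' y' + 2 * \<rho>" "T x' y' \<le> T x y + 2 * \<rho>"
    using tri[of x x' y] tri[of x' y' y] tri[of x' x y'] tri[of x y y']
      Tl[of x x'] Tl[of x' x] Tl[of y y'] Tl[of y' y] dist xX yX x'X y'X by linarith+
  have g_g: "g (x - y) \<le> g (x' - y') + 2 * \<rho>" "g (x' - y') \<le> g (x - y) + 2 * \<rho>"
    using is_norm_triangle_via[OF g(1), of x y x'] is_norm_triangle_via[OF g(1), of x' y y']
      is_norm_triangle_via[OF g(1), of x' y' x] is_norm_triangle_via[OF g(1), of x y' y]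
      g(2)[of "x - x'"] g(2)[of "x' - x"] g(2)[of "y - y'"] g(2)[of "y' - y"] dist by linarith+
  have lower: "lam * g (x' - y') - D \<le> T x' y'"
    unfolding T_def
  proof (rule passage_time_lower_bound[where \<Q> = \<Q> and \<beta> = \<beta> and g = g and lam = lam])
    show "edge_closed Q \<and> convex Q \<and> Q \<subseteq> X" if "Q \<in> \<Q>" for Q
      using that sub edge_closed_cube[OF corner_lattice] convex_cube unfolding \<Q>_def by blast
    show "g (u - w) - D \<le> passage_time b t Q u w" if Q: "Q \<in> \<Q>" "u \<in> Q" "w \<in> Q" for Q u w
    proof -
      obtain k where "\<forall>i. 0 \<le> k i \<and> k i < int K" "Q = cube (corner L k) (real n)"
        using Q(1) unfolding \<Q>_def by blast
      then show ?thesis using core[of k u w] Q by auto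
    qed
    show "lam * g (w - z) + D \<le> \<beta> * l1norm (w - z)"
      if Q: "Q \<in> \<Q>" "Q' \<in> \<Q>" "Q \<noteq> Q'" "w \<in> Q" "z \<in> Q'" for Q Q' w z
    proof -
      obtain k k' where "Q = cube (corner L k) (real n)" "Q' = cube (corner L k') (real n)"
        using Q(1,2) unfolding \<Q>_def by blast
      then have "real m \<le> l1norm (w - z)" using Q core_gap[OF L(1), of k k' w z] by blast
      then have "(\<beta> - lam * b) * real m \<le> (\<beta> - lam * b) * l1norm (w - z)"
        using lam(3) by (intro mult_left_mono) auto
      moreover have "lam * g (w - z) \<le> lam * (b * l1norm (w - z))"
        using g(2) lam(1) by (rule mult_left_mono)
      ultimately show ?thesis using lam(5) by (simp add: algebra_simps)
    qed
    show "\<beta> \<le> t e" if "e \<in> edges_in X" "\<And>Q. Q \<in> \<Q> \<Longrightarrow> \<not> e \<subseteq> Q" for e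
      using that by (intro corridor) (auto simp: X_def \<Q>_def)
    show "cube (corner L k) (real n) \<in> \<Q>" using k unfolding \<Q>_def by blast
  qed (fact X t g D b lam x'Q y'X)+
  have upper: "T x' y' \<le> g (corner n k + p - (corner n k' + p'))
     + (D + b * real m) * of_int (\<Sum>i\<in>UNIV. \<bar>k i - k' i\<bar>) + D"
    unfolding T_def x'_def y'_def L(1)
  proof (rule passage_time_upper_bound[where K = "int K" and g = g])
    show "passage_time b t X u v \<le> g (u - v) + D"
      if "\<And>i. 0 \<le> k i \<and> k i < int K" and uv: "u \<in> cube (corner (n + m) k) (real n)"
        "v \<in> cube (corner (n + m) k) (real n)" for k u v
    proof -
      have "passage_time b t X u v \<le> passage_time b t (cube (corner L k) (real n)) u v"
        using uv sub[of k] that(1) by (intro passage_time_antimono X t0 b) (auto simp: L)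
      then show ?thesis using core[of k u v] that by (auto simp: L)
    qed
    show "cube (corner (n + m) k) (real n) \<subseteq> X" if "\<And>i. 0 \<le> k i \<and> k i < int K" for k
      using sub[of k] that by (simp add: L)
  qed (fact X t b g D k k' p p')+
  define S where "S = real_of_int (\<Sum>i\<in>UNIV. \<bar>k i - k' i\<bar>)"
  have "(\<Sum>i\<in>UNIV. \<bar>k i - k' i\<bar>) \<le> of_nat (card (UNIV :: 'n set)) * int K"
  proof (rule sum_bounded_above)
    fix i show "\<bar>k i - k' i\<bar> \<le> int K" using k[of i] k'[of i] by linarith
  qed
  then have S: "S \<le> d * real K" unfolding S_def d_def
    by (metis of_int_le_iff of_int_mult of_int_of_nat_eq)
  have S0: "0 \<le> S" unfolding S_def by (simp add: sum_nonneg)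
  \<comment> \<open>Undoing the collapse: each unit of index distance restores one gap of width
    \<open>m\<close>.\<close>
  have "corner n k + p - (corner n k' + p') - (x' - y') = - real m *\<^sub>R (\<chi> i. of_int (k i - k' i))"
    unfolding x'_def y'_def L(1) by (simp add: vec_eq_iff algebra_simps)
  then have "l1norm (corner n k + p - (corner n k' + p') - (x' - y')) = real m * S"
    unfolding S_def l1norm_def by (simp add: abs_mult sum_distrib_left)
  then have "g (corner n k + p - (corner n k' + p') - (x' - y')) \<le> b * (real m * S)"
    using g(2) by metis
  then have "g (corner n k + p - (corner n k' + p')) \<le> g (x' - y') + b * (real m * S)"
    using is_norm_triangle_via[OF g(1), of "corner n k + p - (corner n k' + p')" 0 "x' - y'"] by simp
  then have "T x' y' \<le> g (x' - y') + (D + 2 * b * real m) * S + D"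
    using upper unfolding S_def[symmetric] by (simp add: algebra_simps)
  moreover have "(D + 2 * b * real m) * S \<le> (D + 2 * b * real m) * (d * real K)"
    using S D b by (intro mult_left_mono) auto
  ultimately have upper': "T x' y' \<le> g (x' - y') + (D + 2 * b * real m) * d * real K + D"
    by (simp add: mult.assoc)
  have "\<bar>(x' - y') $ i\<bar> \<le> real N" for i
    using x'X y'X unfolding X_def cube_def by (auto simp: abs_le_iff dest!: spec[of _ i])
  then have "l1norm (x' - y') \<le> d * real N" unfolding d_def by (rule l1norm_le_card)
  then have "g (x' - y') \<le> b * (d * real N)" using g(2)[of "x' - y'"] b mult_left_mono by (metis order_trans)
  then have "(1 - lam) * g (x' - y') \<le> (1 - lam) * (b * (d * real N))"
    using lam(2) by (intro mult_left_mono) auto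
  then have lower': "g (x' - y') - (1 - lam) * b * d * real N - D \<le> T x' y'"
    using lower by (simp add: algebra_simps)
  have nn: "0 \<le> (1 - lam) * b * d * real N" "0 \<le> (D + 2 * b * real m) * d * real K"
    using lam b D by (auto simp: d_def)
  have "4 * \<rho> = 8 * b * d * real L" unfolding \<rho>_def by simp
  then show ?thesis
    using lower' upper' g_g T_T nn D unfolding T_def[symmetric] X_def[symmetric] by linarith
qed

section \<open>Measurability\<close>

text \<open>The passage time is an infimum over uncountably many paths.  Since its dependence on the
  passage times of the edges is nonnegative affine along each path, it suffices to consider the
  countably many rational majorants of the coefficients.\<close>

lemma path_time_affine:
  assumes X: "edge_closed X" and fin: "finite (edges_in X)" and p: "is_path X x y p"
  shows "\<exists>l0 l. (\<forall>t. path_time b t p = l0 + (\<Sum>e\<in>edges_in X. t e * l e))"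
  using p
proof (induction rule: is_path_induct)
  case start
  then show ?case by (intro exI[of _ 0] exI[of _ "\<lambda>_. 0"]) simp
next
  case (step p z z')
  obtain l0 l where l: "\<And>t. path_time b t p = l0 + (\<Sum>e\<in>edges_in X. t e * l e)"
    using step.IH by blast
  have snoc: "path_time b t (p @ [z']) = path_time b t p + step_time b t z z'" for t
    using step.hyps by (subst path_time_snoc) (auto simp: is_path_def)
  show ?case
  proof (rule step_time_cases[OF X step.hyps(3,2), of b])
    assume st: "\<And>t. step_time b t z z' = b * l1norm (z - z')"
    show ?thesis using l
      by (intro exI[of _ "l0 + b * l1norm (z - z')"] exI[of _ l]) (simp add: snoc st)
  next
    fix e assume e: "e \<in> edges_in X" and st: "\<And>t. step_time b t z z' = t e * l1norm (z - z')"
    define l' where "l' = l(e := l e + l1norm (z - z'))"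
    have "(\<Sum>e\<in>edges_in X. t e * l' e) = (\<Sum>e\<in>edges_in X. t e * l e) + t e * l1norm (z - z')" for t
    proof -
      have "(\<Sum>e\<in>edges_in X. t e * l' e) = t e * l' e + (\<Sum>e\<in>edges_in X - {e}. t e * l e)"
        using fin e by (subst sum.remove[of _ e]) (auto simp: l'_def)
      also have "\<dots> = t e * l1norm (z - z') + (t e * l e + (\<Sum>e\<in>edges_in X - {e}. t e * l e))"
        by (simp add: l'_def distrib_left)
      also have "t e * l e + (\<Sum>e\<in>edges_in X - {e}. t e * l e) = (\<Sum>e\<in>edges_in X. t e * l e)"
        using fin e by (subst sum.remove[of _ e]) auto
      finally show ?thesis by simp
    qed
    then show ?thesis by (intro exI[of _ l0] exI[of _ l']) (simp add: snoc st l)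
  qed
qed

lemma measurable_passage_time:
  assumes X: "edge_closed X" and fin: "finite (edges_in X)" and b: "0 \<le> b" and xy: "x \<in> X" "y \<in> X"
    and \<nu>: "sets \<nu> = sets (restrict_space borel {0..})"
  shows "(\<lambda>t. passage_time b t X x y) \<in> borel_measurable (PiM (edges_in X) (\<lambda>_. \<nu>))"
  unfolding borel_measurable_iff_less
proof
  fix c :: real
  let ?E = "edges_in X"
  let ?P = "PiM ?E (\<lambda>_. \<nu>)"
  \<comment> \<open>The rational coefficients must dominate those of an actual path; extensionality
    outside \<open>?E\<close> keeps \<open>R\<close> countable.\<close>
  define R where "R = {(r0, r). r0 \<in> \<rat> \<and> r \<in> PiE ?E (\<lambda>_. \<rat>) \<and> (\<exists>p l0 l. is_path X x y p \<and>
     (\<forall>t. path_time b t p = l0 + (\<Sum>e\<in>?E. t e * l e)) \<and> l0 \<le> r0 \<and> (\<forall>e\<in>?E. l e \<le> r e))}"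
  have space: "space \<nu> = {0..}" using sets_eq_imp_space_eq[OF \<nu>] by (simp add: space_restrict_space)
  have id: "(\<lambda>x. x) \<in> borel_measurable \<nu>"
    unfolding measurable_cong_sets[OF \<nu> refl] by (rule measurable_restrict_space1) simp
  have comp: "(\<lambda>t. t e) \<in> borel_measurable ?P" if "e \<in> ?E" for e
    using measurable_compose[OF measurable_component_singleton[OF that] id] by simp
  have nonneg: "\<forall>e\<in>?E. 0 \<le> t e" if "t \<in> space ?P" for t
    using that by (auto simp: space_PiM space PiE_iff)
  have "R \<subseteq> \<rat> \<times> PiE ?E (\<lambda>_. \<rat>)" unfolding R_def by auto
  then have countable: "countable R"
    by (rule countable_subset) (intro countable_SIGMA countable_PiE countable_rat fin)
  have "{t \<in> space ?P. passage_time b t X x y < c} =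
      (\<Union>(r0, r)\<in>R. {t \<in> space ?P. r0 + (\<Sum>e\<in>?E. t e * r e) < c})" (is "?L = ?U")
  proof (intro equalityI subsetI)
    fix t assume "t \<in> ?L"
    then have t: "t \<in> space ?P" "passage_time b t X x y < c" by auto
    obtain p where p: "is_path X x y p" "path_time b t p < c"
      using passage_time_ge[OF xy, of c b t] t(2) by (meson not_le)
    obtain l0 l where l: "\<And>t. path_time b t p = l0 + (\<Sum>e\<in>?E. t e * l e)"
      using path_time_affine[OF X fin p(1)] by blast
    define s where "s = 1 + (\<Sum>e\<in>?E. t e)"
    have s: "0 < s" using nonneg[OF t(1)] unfolding s_def by (simp add: add_pos_nonneg sum_nonneg)
    \<comment> \<open>The constant and each coefficient will rise by less than
      \<open>\<delta>\<close>, so the value rises by less than \<open>\<delta> * s\<close>, which is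
      the slack below \<open>c\<close>.\<close>
    define \<delta> where "\<delta> = (c - path_time b t p) / s"
    have \<delta>: "0 < \<delta>" "\<delta> * s = c - path_time b t p" using p(2) s unfolding \<delta>_def by auto
    obtain r0 where r0: "r0 \<in> \<rat>" "l0 < r0" "r0 < l0 + \<delta>"
      using Rats_dense_in_real[of l0 "l0 + \<delta>"] \<delta>(1) by auto
    have "\<forall>e. \<exists>r\<in>\<rat>. l e < r \<and> r < l e + \<delta>"
      using Rats_dense_in_real \<delta>(1) by (metis less_add_same_cancel1)
    then obtain r where r: "\<And>e. r e \<in> \<rat> \<and> l e < r e \<and> r e < l e + \<delta>" by metis
    have "(\<Sum>e\<in>?E. t e * r e) \<le> (\<Sum>e\<in>?E. t e * (l e + \<delta>))"
      using nonneg[OF t(1)] r by (intro sum_mono mult_left_mono) (auto intro: less_imp_le)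
    also have "\<dots> = (\<Sum>e\<in>?E. t e * l e) + \<delta> * (s - 1)"
      unfolding s_def by (simp add: distrib_left sum.distrib sum_distrib_left mult.commute)
    finally have "r0 + (\<Sum>e\<in>?E. t e * r e) < c"
      using r0(3) \<delta>(2) l[of t] by (simp add: right_diff_distrib)
    then have "r0 + (\<Sum>e\<in>?E. t e * restrict r ?E e) < c" by simp
    moreover have "(r0, restrict r ?E) \<in> R"
      unfolding R_def using p(1) l r0 r by (auto intro!: exI[of _ p] exI[of _ l0] exI[of _ l] less_imp_le)
    ultimately show "t \<in> ?U" using t(1) by blast
  next
    fix t assume "t \<in> ?U"
    then obtain r0 r where R: "(r0, r) \<in> R" and t: "t \<in> space ?P" "r0 + (\<Sum>e\<in>?E. t e * r e) < c" by blast
    obtain p l0 l where p: "is_path X x y p" "path_time b t p = l0 + (\<Sum>e\<in>?E. t e * l e)"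
      "l0 \<le> r0" "\<forall>e\<in>?E. l e \<le> r e" using R unfolding R_def by blast
    have "(\<Sum>e\<in>?E. t e * l e) \<le> (\<Sum>e\<in>?E. t e * r e)"
      using p(4) nonneg[OF t(1)] by (intro sum_mono mult_left_mono) auto
    moreover have "passage_time b t X x y \<le> path_time b t p"
      using nonneg[OF t(1)] by (intro passage_time_le X b p(1)) auto
    ultimately show "t \<in> ?L" using p t by auto
  qed
  also have "\<dots> \<in> sets ?P"
  proof (intro sets.countable_UN'[OF countable] subsetI, clarify)
    fix r0 r
    have "(\<lambda>t. r0 + (\<Sum>e\<in>?E. t e * r e)) \<in> borel_measurable ?P"
      using comp by (intro borel_measurable_add borel_measurable_sum borel_measurable_times) auto
    then show "{t \<in> space ?P. r0 + (\<Sum>e\<in>?E. t e * r e) < c} \<in> sets ?P"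
      unfolding borel_measurable_iff_less by blast
  qed
  finally show "{t \<in> space ?P. passage_time b t X x y < c} \<in> sets ?P" .
qed

text \<open>The large deviation event before rescaling: on the cube of side \<open>n\<close> the
  bound \<open>c\<close> is \<open>\<epsilon> * n\<close>. Being a predicate on realisations, it can
  be used both on the probability space and on product spaces of edge times.\<close>

definition close_to_norm ::
  "real \<Rightarrow> (real ^ 'n \<Rightarrow> real) \<Rightarrow> real \<Rightarrow> (real ^ 'n) set \<Rightarrow> ((real ^ 'n) set \<Rightarrow> real) \<Rightarrow> bool" where
  "close_to_norm b g c X t \<longleftrightarrow> (\<forall>x\<in>X. \<forall>y\<in>X. \<bar>g (x - y) - passage_time b t X x y\<bar> \<le> c)"

text \<open>For a fixed realisation both \<open>g\<close> and the passage time are Lipschitz in the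
  endpoints with respect to \<open>l1norm\<close>, so a bound on a dense set extends to
  \<open>X\<close>.\<close>

lemma close_to_norm_dense:
  fixes X :: "(real ^ 'n) set"
  assumes X: "edge_closed X" and fin: "finite (edges_in X)" and b: "0 \<le> b"
    and t: "\<forall>e\<in>edges_in X. 0 \<le> t e" and g: "is_norm g" "\<And>x. g x \<le> b * l1norm x"
    and D: "D \<subseteq> X" "X \<subseteq> closure D"
    and le: "\<And>x y. x \<in> D \<Longrightarrow> y \<in> D \<Longrightarrow> \<bar>g (x - y) - passage_time b t X x y\<bar> \<le> c"
  shows "close_to_norm b g c X t"
  unfolding close_to_norm_def
proof (intro ballI)
  fix x y assume xy: "x \<in> X" "y \<in> X"
  obtain u where u: "\<And>n. u n \<in> D" "u \<longlonglongrightarrow> x" using xy D(2) closure_sequential by blast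
  obtain v where v: "\<And>n. v n \<in> D" "v \<longlonglongrightarrow> y" using xy D(2) closure_sequential by blast
  define T where "T = passage_time b t X"
  define C where "C = b + (\<Sum>e\<in>edges_in X. t e)"
  have S0: "0 \<le> (\<Sum>e\<in>edges_in X. t e)" using t by (simp add: sum_nonneg)
  have tC: "\<forall>e\<in>edges_in X. 0 \<le> t e \<and> t e \<le> C"
  proof
    fix e assume e: "e \<in> edges_in X"
    have "t e \<le> (\<Sum>e\<in>edges_in X. t e)" using fin e t by (intro member_le_sum) auto
    then show "0 \<le> t e \<and> t e \<le> C" using t e b unfolding C_def by auto
  qed
  have bC: "b \<le> C" using S0 unfolding C_def by simp
  have T: "T z w \<le> C * l1norm (z - w)" if "z \<in> X" "w \<in> X" for z w
    unfolding T_def using that by (intro passage_time_le_l1norm X tC b bC)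
  have tri: "T z w \<le> T z z' + T z' w" if "z \<in> X" "w \<in> X" "z' \<in> X" for z z' w
    unfolding T_def using that by (intro passage_time_triangle X t b)
  have gC: "g z \<le> C * l1norm z" for z
    using g(2)[of z] mult_right_mono[OF bC, of "l1norm z"] by simp
  have uX: "u n \<in> X" and vX: "v n \<in> X" for n using u v D by auto
  define \<eta> where "\<eta> n = C * l1norm (x - u n) + C * l1norm (y - v n)" for n
  have bound: "\<bar>g (x - y) - T x y\<bar> \<le> c + 2 * \<eta> n" for n
  proof -
    have "\<bar>g (u n - v n) - T (u n) (v n)\<bar> \<le> c" unfolding T_def using le u v by auto
    moreover have "\<bar>T x y - T (u n) (v n)\<bar> \<le> \<eta> n"
      using tri[OF xy uX[of n]] tri[OF uX[of n] xy(2) vX[of n]] tri[OF uX[of n] vX[of n] xy(1)]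
        tri[OF xy(1) vX[of n] xy(2)] T[OF xy(1) uX[of n]] T[OF uX[of n] xy(1)]
        T[OF xy(2) vX[of n]] T[OF vX[of n] xy(2)]
      unfolding \<eta>_def l1norm_minus_commute[of "u n" x] l1norm_minus_commute[of "v n" y] by linarith
    moreover have "\<bar>g (x - y) - g (u n - v n)\<bar> \<le> \<eta> n"
      using is_norm_triangle_via[OF g(1), of x y "u n"] is_norm_triangle_via[OF g(1), of "u n" y "v n"]
        is_norm_triangle_via[OF g(1), of "u n" "v n" x] is_norm_triangle_via[OF g(1), of x "v n" y]
        gC[of "x - u n"] gC[of "u n - x"] gC[of "y - v n"] gC[of "v n - y"]
      unfolding \<eta>_def l1norm_minus_commute[of "u n" x] l1norm_minus_commute[of "v n" y] by linarith
    ultimately show ?thesis by linarith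
  qed
  have l1: "(\<lambda>n. l1norm (z - w n)) \<longlonglongrightarrow> 0" if "w \<longlonglongrightarrow> z" for z and w :: "nat \<Rightarrow> real ^ 'n"
  proof -
    have "(\<lambda>n. z - w n) \<longlonglongrightarrow> z - z" using that by (intro tendsto_intros)
    moreover have "isCont l1norm (0 :: real ^ 'n)"
      using continuous_l1norm[where 'n = 'n] by (simp add: continuous_on_eq_continuous_at)
    ultimately show ?thesis using isCont_tendsto_compose[of 0 l1norm "\<lambda>n. z - w n"] by simp
  qed
  have "(\<lambda>n. c + 2 * \<eta> n) \<longlonglongrightarrow> c + 2 * (C * 0 + C * 0)"
    unfolding \<eta>_def using l1 u v by (intro tendsto_intros) auto
  then have "\<bar>g (x - y) - T x y\<bar> \<le> c + 2 * (C * 0 + C * 0)"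
    using bound by (intro LIMSEQ_le_const) auto
  then show "\<bar>g (x - y) - passage_time b t X x y\<bar> \<le> c" unfolding T_def by simp
qed

text \<open>Restricting the endpoints to a countable dense set turns the uncountable intersection
  into a countable one.\<close>

lemma sets_close_to_norm:
  fixes X :: "(real ^ 'n) set"
  assumes X: "edge_closed X" and fin: "finite (edges_in X)" and b: "0 \<le> b"
    and g: "is_norm g" "\<And>x. g x \<le> b * l1norm x"
    and \<nu>: "sets \<nu> = sets (restrict_space borel {0..})"
  shows "{t \<in> space (PiM (edges_in X) (\<lambda>_. \<nu>)). close_to_norm b g c X t} \<in> sets (PiM (edges_in X) (\<lambda>_. \<nu>))"
proof -
  let ?P = "PiM (edges_in X) (\<lambda>_. \<nu>)"
  obtain D where D: "countable D" "D \<subseteq> X" "X \<subseteq> closure D" by (rule separable)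
  have space: "space \<nu> = {0..}" using sets_eq_imp_space_eq[OF \<nu>] by (simp add: space_restrict_space)
  have nonneg: "\<forall>e\<in>edges_in X. 0 \<le> t e" if "t \<in> space ?P" for t
    using that by (auto simp: space_PiM space PiE_iff)
  have "{t \<in> space ?P. close_to_norm b g c X t} =
      {t \<in> space ?P. \<forall>x\<in>D. \<forall>y\<in>D. \<bar>g (x - y) - passage_time b t X x y\<bar> \<le> c}"
    using close_to_norm_dense[OF X fin b nonneg g D(2,3)] D(2)
    unfolding close_to_norm_def by blast
  also have "\<dots> \<in> sets ?P"
  proof (intro sets.sets_Collect_countable_All' D(1))
    fix x y assume "x \<in> D" "y \<in> D"
    then have [measurable]: "(\<lambda>t. passage_time b t X x y) \<in> borel_measurable ?P"
      using D(2) by (intro measurable_passage_time X fin b \<nu>) auto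
    show "{t \<in> space ?P. \<bar>g (x - y) - passage_time b t X x y\<bar> \<le> c} \<in> sets ?P" by measurable
  qed
  finally show ?thesis .
qed

section \<open>Counting the corridor edges\<close>

text \<open>Serves as index set of the cores, as set of offsets inside a core and, through
  \<open>corner 1\<close>, as set of lattice points of a cube.\<close>

definition index_box :: "nat \<Rightarrow> ('n::finite \<Rightarrow> int) set" where
  "index_box K = {k. \<forall>i. 0 \<le> k i \<and> k i < int K}"

lemma index_box_eq_PiE: "index_box K = PiE UNIV (\<lambda>_. {0..<int K})"
  by (auto simp: index_box_def PiE_def Pi_def)

lemma finite_index_box [simp]: "finite (index_box K)"
  unfolding index_box_eq_PiE by (rule finite_PiE) auto

lemma card_index_box: "card (index_box K :: ('n::finite \<Rightarrow> int) set) = K ^ CARD('n)"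
  unfolding index_box_eq_PiE by (subst card_PiE) auto

lemma edges_in_cube_subset:
  "edges_in (cube 0 (real N)) \<subseteq>
     (\<lambda>(j, i). {corner 1 j, corner 1 j + axis i 1}) ` (index_box (Suc N) \<times> UNIV)"
proof
  fix e assume "e \<in> edges_in (cube 0 (real N))"
  then have e: "e \<in> edges" "e \<subseteq> cube 0 (real N)" unfolding edges_in_def by auto
  obtain v i where v: "v \<in> lattice" "e = {v, v + axis i 1}" using e(1) by (rule edgesE)
  define j where "j l = \<lfloor>v $ l\<rfloor>" for l
  have j: "of_int (j l) = v $ l" for l
    using v(1) unfolding j_def lattice_def by (auto simp: of_int_floor)
  then have "corner 1 j = v" by (simp add: vec_eq_iff)
  moreover have "j \<in> index_box (Suc N)"
  proof -
    have vN: "0 \<le> v $ l \<and> v $ l \<le> real N" for l using e(2) v(2) unfolding cube_def by simp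
    have "0 \<le> j l \<and> j l < int (Suc N)" for l
      using vN[of l] unfolding j[symmetric] by linarith
    then show ?thesis unfolding index_box_def by simp
  qed
  ultimately show "e \<in> (\<lambda>(j, i). {corner 1 j, corner 1 j + axis i 1}) ` (index_box (Suc N) \<times> UNIV)"
    using v(2) by (intro image_eqI[of _ _ "(j, i)"]) auto
qed

lemma finite_edges_in_cube: "finite (edges_in (cube 0 (real N)))"
  by (rule finite_subset[OF edges_in_cube_subset]) auto

text \<open>Besides the corridors between cores, this contains the edges of the incomplete layer
  beyond \<open>L * K\<close>.\<close>

definition corridor_edges :: "nat \<Rightarrow> nat \<Rightarrow> nat \<Rightarrow> nat \<Rightarrow> (real ^ 'n) set set" where
  "corridor_edges L n K N =
     edges_in (cube 0 (real N)) - (\<Union>k\<in>index_box K. edges_in (cube (corner L k) (real n)))"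

text \<open>Edges are counted by lower endpoint and direction. The lattice points of a core that lie
  on none of its upper faces are lower endpoints of core edges only, and there are
  \<open>(K * n) ^ d\<close> of them among the \<open>(N + 1) ^ d\<close> points of the large
  cube.\<close>

lemma card_corridor_edges:
  assumes L: "L = n + m" "0 < L" and K: "K = N div L"
  shows "real (card (corridor_edges L n K N :: (real ^ 'n) set set)) \<le>
     real CARD('n) * (real (Suc N) ^ CARD('n) - (real K * real n) ^ CARD('n))"
proof -
  define F :: "('n \<Rightarrow> int) \<times> ('n \<Rightarrow> int) \<Rightarrow> 'n \<Rightarrow> int" where "F = (\<lambda>(k, r) i. int L * k i + r i)"
  define H where "H = F ` (index_box K \<times> index_box n)"
  have LK: "L * K \<le> N" unfolding K by simp
  have "inj_on F (index_box K \<times> index_box n)"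
  proof (rule inj_onI, clarify)
    fix k r k' r' assume "k \<in> index_box K" "r \<in> index_box n" "k' \<in> index_box K" "r' \<in> index_box n"
      and eq: "F (k, r) = F (k', r')"
    then have r: "0 \<le> r i" "r i < int L" "0 \<le> r' i" "r' i < int L" for i
      using L(1) unfolding index_box_def by (auto intro: less_le_trans)
    have *: "int L * k i + r i = int L * k' i + r' i" for i using fun_cong[OF eq, of i] unfolding F_def by simp
    \<comment> \<open>Offsets are below \<open>n \<le> L\<close>, so quotient and remainder by
      \<open>L\<close> recover index and offset.\<close>
    have "k i = k' i" for i
      using arg_cong[OF *[of i], of "\<lambda>x. x div int L"] r[of i] L(2) by simp
    moreover have "r i = r' i" for i
      using arg_cong[OF *[of i], of "\<lambda>x. x mod int L"] r[of i] L(2) by simp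
    ultimately show "k = k' \<and> r = r'" by auto
  qed
  then have cardH: "card H = K ^ CARD('n) * n ^ CARD('n)"
    unfolding H_def by (simp add: card_image card_cartesian_product card_index_box)
  have HV: "H \<subseteq> index_box (Suc N)"
  proof
    fix j assume "j \<in> H"
    then obtain k r where kr: "k \<in> index_box K" "r \<in> index_box n" "j = F (k, r)" unfolding H_def by auto
    have "0 \<le> int L * k i + r i \<and> int L * k i + r i < int (Suc N)" for i
    proof -
      have b: "0 \<le> k i" "k i \<le> int K - 1" "0 \<le> r i" "r i < int n"
        using kr unfolding index_box_def by auto
      have "int L * k i \<le> int L * (int K - 1)" using b by (intro mult_left_mono) auto
      moreover have "int L * int K \<le> int N" using LK by (metis of_nat_le_iff of_nat_mult)
      ultimately show ?thesis using b L by (auto simp: algebra_simps)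
    qed
    then show "j \<in> index_box (Suc N)" unfolding index_box_def kr F_def by simp
  qed
  have "corridor_edges L n K N \<subseteq>
      (\<lambda>(j, i). {corner 1 j, corner 1 j + axis i (1::real)}) ` ((index_box (Suc N) - H) \<times> (UNIV :: 'n set))"
  proof
    fix e :: "(real ^ 'n) set" assume e: "e \<in> corridor_edges L n K N"
    then have "e \<in> edges_in (cube 0 (real N))" unfolding corridor_edges_def by simp
    from subsetD[OF edges_in_cube_subset this]
    obtain j i where j: "j \<in> index_box (Suc N)" "e = {corner 1 j, corner 1 j + axis i 1}"
      by auto
    have "j \<notin> H"
    proof
      assume "j \<in> H"
      then obtain k r where kr: "k \<in> index_box K" "r \<in> index_box n" "j = F (k, r)" unfolding H_def by auto
      have jl: "real_of_int (j l) = real L * of_int (k l) + of_int (r l)" for l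
        unfolding kr F_def by simp
      have r: "0 \<le> real_of_int (r l)" "real_of_int (r l) + 1 \<le> real n" for l
      proof -
        have "0 \<le> r l \<and> r l < int n" using kr(2) unfolding index_box_def by blast
        then show "0 \<le> real_of_int (r l)" "real_of_int (r l) + 1 \<le> real n" by linarith+
      qed
      have jb: "real L * of_int (k l) \<le> corner 1 j $ l \<and> corner 1 j $ l + 1 \<le> real L * of_int (k l) + real n" for l
        using r[of l] by (simp add: jl)
      have "real L * of_int (k l) \<le> (corner 1 j + s *\<^sub>R axis i 1) $ l \<and>
          (corner 1 j + s *\<^sub>R axis i 1) $ l \<le> real L * of_int (k l) + real n"
        if "0 \<le> s" "s \<le> 1" for s l
        using jb[of l] that by (cases "l = i") (auto simp: axis_def)
      from this[of 0] this[of 1] have "e \<subseteq> cube (corner L k) (real n)"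
        unfolding j(2) cube_def by simp
      then show False using e kr(1) unfolding corridor_edges_def edges_in_def by auto
    qed
    then show "e \<in> (\<lambda>(j, i). {corner 1 j, corner 1 j + axis i 1}) ` ((index_box (Suc N) - H) \<times> UNIV)"
      using j by (intro image_eqI[of _ _ "(j, i)"]) auto
  qed
  then have "card (corridor_edges L n K N :: (real ^ 'n) set set) \<le> card ((index_box (Suc N) - H) \<times> (UNIV :: 'n set))"
    by (rule surj_card_le[rotated]) auto
  also have "\<dots> = (card (index_box (Suc N) :: ('n \<Rightarrow> int) set) - card H) * CARD('n)"
    using HV finite_subset[OF HV] by (simp add: card_cartesian_product card_Diff_subset)
  finally have "real (card (corridor_edges L n K N :: (real ^ 'n) set set)) \<le>
      real ((card (index_box (Suc N) :: ('n \<Rightarrow> int) set) - card H) * CARD('n))"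
    by (simp only: of_nat_le_iff)
  also have "\<dots> = real CARD('n) * (real (Suc N) ^ CARD('n) - (real K * real n) ^ CARD('n))"
    using card_mono[OF finite_index_box HV]
    by (simp add: of_nat_diff card_index_box cardH power_mult_distrib mult.commute del: of_nat_Suc)
  finally show ?thesis .
qed

section \<open>Independence and stationarity\<close>

lemma close_to_norm_cong:
  assumes "edge_closed X" "\<forall>e\<in>edges_in X. t e = t' e"
  shows "close_to_norm b g c X t \<longleftrightarrow> close_to_norm b g c X t'"
  using passage_time_cong[OF assms] unfolding close_to_norm_def by simp

lemma close_to_norm_translate:
  assumes "v \<in> lattice"
  shows "close_to_norm b g c ((+) v ` X) t \<longleftrightarrow> close_to_norm b g c X (\<lambda>e. t ((+) v ` e))"
  unfolding close_to_norm_def by (simp add: passage_time_translate[OF assms])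

lemma edges_in_translate:
  assumes v: "v \<in> lattice"
  shows "edges_in ((+) v ` X) = (`) ((+) v) ` edges_in X"
proof (intro equalityI subsetI)
  fix e assume e: "e \<in> edges_in ((+) v ` X)"
  have eq: "e = (+) v ` ((+) (- v) ` e)" by (simp add: image_image)
  have "(+) (- v) ` e \<subseteq> (+) (- v) ` (+) v ` X" using e unfolding edges_in_def by blast
  then have "(+) (- v) ` e \<subseteq> X" by (simp add: image_image)
  moreover have "(+) (- v) ` e \<in> edges"
    using e edges_translate[OF lattice_uminus[OF v]] unfolding edges_in_def by blast
  ultimately have "(+) (- v) ` e \<in> edges_in X" unfolding edges_in_def by simp
  then show "e \<in> (`) ((+) v) ` edges_in X" using eq by blast
qed (auto simp: edges_in_def edges_translate_iff[OF v])

lemma edges_in_subset: "edges_in X \<subseteq> edges"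
  unfolding edges_in_def by blast

lemma zero_in_lattice: "0 \<in> lattice"
  by (simp add: lattice_def)

lemma scaled_unit_cube: "0 < n \<Longrightarrow> (\<lambda>z. real n *\<^sub>R z) ` unit_cube = cube 0 (real n)"
proof (intro equalityI subsetI)
  fix x :: "real ^ 'n" assume n: "0 < n" and "x \<in> cube 0 (real n)"
  then have "x = real n *\<^sub>R ((1 / real n) *\<^sub>R x)" "(1 / real n) *\<^sub>R x \<in> unit_cube"
    by (auto simp: cube_def unit_cube_def field_simps)
  then show "x \<in> (\<lambda>z. real n *\<^sub>R z) ` unit_cube" by blast
qed (auto simp: cube_def unit_cube_def mult_left_le)

lemma LD_event_eq:
  assumes n: "0 < n" and g: "is_norm g"
  shows "LD_event M \<tau> b unit_cube n g \<epsilon> =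
     {\<omega> \<in> space M. close_to_norm b g (\<epsilon> * real n) (cube 0 (real n)) (\<lambda>e. \<tau> e \<omega>)}"
proof -
  have "\<bar>g (x - y) - rescaled_passage_time b t n unit_cube x y\<bar> \<le> \<epsilon> \<longleftrightarrow>
      \<bar>g (real n *\<^sub>R x - real n *\<^sub>R y) - passage_time b t (cube 0 (real n)) (real n *\<^sub>R x) (real n *\<^sub>R y)\<bar>
        \<le> \<epsilon> * real n" for x y t
  proof -
    have "g (real n *\<^sub>R x - real n *\<^sub>R y) = real n * g (x - y)"
      using is_norm_scale[OF g, of "real n" "x - y"] by (simp add: scaleR_diff_right)
    then have "g (x - y) - rescaled_passage_time b t n unit_cube x y =
        (g (real n *\<^sub>R x - real n *\<^sub>R y) - passage_time b t (cube 0 (real n)) (real n *\<^sub>R x) (real n *\<^sub>R y)) / real n"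
      using n unfolding rescaled_passage_time_def scaled_unit_cube[OF n] by (simp add: field_simps)
    then show ?thesis using n by (simp add: abs_divide divide_le_eq)
  qed
  then have "close_to_norm b g (\<epsilon> * real n) (cube 0 (real n)) t \<longleftrightarrow>
      (\<forall>x\<in>unit_cube. \<forall>y\<in>unit_cube. \<bar>g (x - y) - rescaled_passage_time b t n unit_cube x y\<bar> \<le> \<epsilon>)" for t
    unfolding close_to_norm_def scaled_unit_cube[OF n, symmetric] by simp
  then show ?thesis unfolding LD_event_def by (simp add: SUP_le_iff)
qed

section \<open>The i.i.d. model: support of the law, independent blocks, stationarity\<close>

locale iid_passage = prob_space M
  for M :: "'w measure" +
  fixes \<nu> :: "real measure" and \<tau> :: "(real ^ 'n) set \<Rightarrow> 'w \<Rightarrow> real"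
    and b :: real and g :: "real ^ 'n \<Rightarrow> real"
  assumes law: "law_on_nonneg \<nu>"
    and iid: "iid_passage_times M \<nu> \<tau>"
    and sup: "ereal b = (SUP x\<in>law_support \<nu>. ereal x)"
    and b_pos: "0 < b"
    and norm_g: "is_norm g"
    and g_le: "g x \<le> b * l1norm x"
begin

lemma sets_nu: "sets \<nu> = sets (restrict_space borel {0..})"
  using law unfolding law_on_nonneg_def by simp

lemma space_nu: "space \<nu> = {0..}"
  using sets_eq_imp_space_eq[OF sets_nu] by (simp add: space_restrict_space)

lemma prob_space_nu: "prob_space \<nu>"
  using law unfolding law_on_nonneg_def by simp

lemma sets_nu_Int: "U \<in> sets borel \<Longrightarrow> U \<inter> space \<nu> \<in> sets \<nu>"
  unfolding sets_nu space_nu sets_restrict_space by auto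

text \<open>A point of the space above \<open>b\<close> is outside the support, hence has a null
  open neighbourhood; by Lindelof's theorem countably many null open sets cover all such
  points.\<close>

lemma null_above: "{x \<in> space \<nu>. b < x} \<in> null_sets \<nu>"
proof -
  interpret nu: prob_space \<nu> by (rule prob_space_nu)
  define \<U> where "\<U> = {U. open U \<and> measure \<nu> (U \<inter> space \<nu>) = 0}"
  obtain \<V> where V: "\<V> \<subseteq> \<U>" "countable \<V>" "\<Union>\<V> = \<Union>\<U>"
    using Lindelof[of \<U>] unfolding \<U>_def by blast
  have "(\<Union>U\<in>\<V>. U \<inter> space \<nu>) \<in> null_sets \<nu>"
  proof (rule null_sets_UN'[OF V(2)])
    fix U assume "U \<in> \<V>"
    then have U: "open U" "measure \<nu> (U \<inter> space \<nu>) = 0" using V(1) unfolding \<U>_def by auto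
    then show "U \<inter> space \<nu> \<in> null_sets \<nu>"
      using sets_nu_Int[of U] by (auto simp: null_sets_def nu.emeasure_eq_measure)
  qed
  moreover have "{x \<in> space \<nu>. b < x} \<subseteq> (\<Union>U\<in>\<V>. U \<inter> space \<nu>)"
  proof
    fix x assume x: "x \<in> {x \<in> space \<nu>. b < x}"
    have "x \<notin> law_support \<nu>"
    proof
      assume "x \<in> law_support \<nu>"
      then have "ereal x \<le> ereal b" unfolding sup by (rule SUP_upper)
      then show False using x by simp
    qed
    then obtain U where "open U" "x \<in> U" "\<not> 0 < measure \<nu> (U \<inter> space \<nu>)"
      using x unfolding law_support_def by blast
    then have "U \<in> \<U>" "x \<in> U" unfolding \<U>_def by (auto simp: not_less measure_le_0_iff)
    then show "x \<in> (\<Union>U\<in>\<V>. U \<inter> space \<nu>)" using V(3) x by blast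
  qed
  moreover have "{x \<in> space \<nu>. b < x} \<in> sets \<nu>"
    using sets_nu_Int[of "{b<..}"] by (simp add: Int_def conj_commute)
  ultimately show ?thesis using null_sets_subset by blast
qed

text \<open>As \<open>b\<close> is the supremum of the support, some support point lies above
  \<open>\<beta>\<close>, and \<open>{\<beta><..}\<close> is an open neighbourhood of it.\<close>

lemma tail_pos:
  assumes "\<beta> < b"
  shows "0 < measure \<nu> {x \<in> space \<nu>. \<beta> \<le> x}"
proof -
  interpret nu: prob_space \<nu> by (rule prob_space_nu)
  have "ereal \<beta> < (SUP x\<in>law_support \<nu>. ereal x)" using assms by (simp flip: sup)
  then obtain x where x: "x \<in> law_support \<nu>" "\<beta> < x" by (auto simp: less_SUP_iff)
  then have "0 < measure \<nu> ({\<beta><..} \<inter> space \<nu>)" unfolding law_support_def by auto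
  also have "\<dots> \<le> measure \<nu> {x \<in> space \<nu>. \<beta> \<le> x}"
    using sets_nu_Int[of "{\<beta>..}"] by (intro nu.finite_measure_mono) (auto simp: Int_def conj_commute)
  finally show ?thesis .
qed

lemma indep: "indep_vars (\<lambda>_. \<nu>) \<tau> edges"
  using iid unfolding iid_passage_times_def by simp

lemma measurable_tau: "e \<in> edges \<Longrightarrow> \<tau> e \<in> measurable M \<nu>"
  using indep unfolding indep_vars_def by simp

lemma distr_tau: "e \<in> edges \<Longrightarrow> distr M \<nu> (\<tau> e) = \<nu>"
  using iid unfolding iid_passage_times_def by simp

lemma tau_nonneg: "e \<in> edges \<Longrightarrow> \<omega> \<in> space M \<Longrightarrow> 0 \<le> \<tau> e \<omega>"
  using measurable_space[OF measurable_tau] unfolding space_nu by auto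

lemma AE_tau_le: "e \<in> edges \<Longrightarrow> AE \<omega> in M. \<tau> e \<omega> \<le> b"
proof -
  assume e: "e \<in> edges"
  have "AE x in \<nu>. x \<le> b"
    by (rule AE_I'[OF null_above]) auto
  then have "AE x in distr M \<nu> (\<tau> e). x \<le> b" unfolding distr_tau[OF e] .
  then show ?thesis by (rule AE_distrD[OF measurable_tau[OF e]])
qed

lemma measurable_restrict_tau:
  "E \<subseteq> edges \<Longrightarrow> (\<lambda>\<omega>. \<lambda>e\<in>E. \<tau> e \<omega>) \<in> measurable M (PiM E (\<lambda>_. \<nu>))"
  by (intro measurable_restrict measurable_tau) auto

lemma distr_restrict_tau:
  assumes "E \<subseteq> edges" "E \<noteq> {}"
  shows "distr M (PiM E (\<lambda>_. \<nu>)) (\<lambda>\<omega>. \<lambda>e\<in>E. \<tau> e \<omega>) = PiM E (\<lambda>_. \<nu>)"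
proof -
  have "indep_vars (\<lambda>_. \<nu>) \<tau> E" using indep assms(1) by (rule indep_vars_subset)
  then have "distr M (PiM E (\<lambda>_. \<nu>)) (\<lambda>\<omega>. \<lambda>e\<in>E. \<tau> e \<omega>) = PiM E (\<lambda>e. distr M \<nu> (\<tau> e))"
    using assms measurable_tau by (subst (asm) indep_vars_iff_distr_eq_PiM') auto
  also have "\<dots> = PiM E (\<lambda>_. \<nu>)" using assms distr_tau by (intro PiM_cong) auto
  finally show ?thesis .
qed

lemma prob_blocks:
  assumes "finite J" "J \<noteq> {}" "\<And>j. j \<in> J \<Longrightarrow> E j \<subseteq> edges" "disjoint_family_on E J"
    and "\<And>j. j \<in> J \<Longrightarrow> S j \<in> sets (PiM (E j) (\<lambda>_. \<nu>))"
  shows "prob {\<omega> \<in> space M. \<forall>j\<in>J. (\<lambda>e\<in>E j. \<tau> e \<omega>) \<in> S j} =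
     (\<Prod>j\<in>J. prob {\<omega> \<in> space M. (\<lambda>e\<in>E j. \<tau> e \<omega>) \<in> S j})"
proof -
  have "indep_vars (\<lambda>j. PiM (E j) (\<lambda>_. \<nu>)) (\<lambda>j \<omega>. \<lambda>e\<in>E j. \<tau> e \<omega>) J"
    by (rule indep_vars_restrict[OF indep assms(3,4)])
  from indep_varsD[OF this assms(2,1) order_refl assms(5)]
  have "prob (\<Inter>j\<in>J. (\<lambda>\<omega>. \<lambda>e\<in>E j. \<tau> e \<omega>) -` S j \<inter> space M) =
     (\<Prod>j\<in>J. prob ((\<lambda>\<omega>. \<lambda>e\<in>E j. \<tau> e \<omega>) -` S j \<inter> space M))" .
  moreover have "(\<Inter>j\<in>J. (\<lambda>\<omega>. \<lambda>e\<in>E j. \<tau> e \<omega>) -` S j \<inter> space M) =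
     {\<omega> \<in> space M. \<forall>j\<in>J. (\<lambda>e\<in>E j. \<tau> e \<omega>) \<in> S j}" using assms(2) by auto
  moreover have "(\<lambda>\<omega>. \<lambda>e\<in>E j. \<tau> e \<omega>) -` S j \<inter> space M =
     {\<omega> \<in> space M. (\<lambda>e\<in>E j. \<tau> e \<omega>) \<in> S j}" for j by auto
  ultimately show ?thesis by simp
qed

text \<open>Taken in the product space over the edges of \<open>X\<close>, so that independence of
  blocks and reindexing of product measures apply.\<close>

definition good :: "real \<Rightarrow> (real ^ 'n) set \<Rightarrow> ((real ^ 'n) set \<Rightarrow> real) set" where
  "good c X = {t \<in> space (PiM (edges_in X) (\<lambda>_. \<nu>)). close_to_norm b g c X t}"

lemma sets_good:
  assumes "edge_closed X" "finite (edges_in X)"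
  shows "good c X \<in> sets (PiM (edges_in X) (\<lambda>_. \<nu>))"
  unfolding good_def
  by (rule sets_close_to_norm[OF assms less_imp_le[OF b_pos] norm_g g_le sets_nu])

lemma restrict_tau_in_good_iff:
  assumes "edge_closed X" "\<omega> \<in> space M"
  shows "(\<lambda>e\<in>edges_in X. \<tau> e \<omega>) \<in> good c X \<longleftrightarrow> close_to_norm b g c X (\<lambda>e. \<tau> e \<omega>)"
proof -
  have "(\<lambda>e\<in>edges_in X. \<tau> e \<omega>) \<in> space (PiM (edges_in X) (\<lambda>_. \<nu>))"
    by (rule measurable_space[OF measurable_restrict_tau[OF edges_in_subset] assms(2)])
  moreover have "close_to_norm b g c X (\<lambda>e\<in>edges_in X. \<tau> e \<omega>) \<longleftrightarrow> close_to_norm b g c X (\<lambda>e. \<tau> e \<omega>)"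
    by (rule close_to_norm_cong[OF assms(1)]) simp
  ultimately show ?thesis unfolding good_def by simp
qed

lemma LD_event_eq_good:
  assumes "0 < n"
  shows "LD_event M \<tau> b unit_cube n g \<epsilon> =
    {\<omega> \<in> space M. (\<lambda>e\<in>edges_in (cube 0 (real n)). \<tau> e \<omega>) \<in> good (\<epsilon> * real n) (cube 0 (real n))}"
  unfolding LD_event_eq[OF assms norm_g]
  using restrict_tau_in_good_iff[OF edge_closed_cube[OF zero_in_lattice]] by auto

lemma sets_restrict_tau:
  assumes "E \<subseteq> edges" "S \<in> sets (PiM E (\<lambda>_. \<nu>))"
  shows "{\<omega> \<in> space M. (\<lambda>e\<in>E. \<tau> e \<omega>) \<in> S} \<in> events"
  using measurable_sets[OF measurable_restrict_tau[OF assms(1)] assms(2)]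
  by (simp add: vimage_def Int_def conj_commute)

lemma LD_event_in_events: "0 < n \<Longrightarrow> LD_event M \<tau> b unit_cube n g \<epsilon> \<in> events"
  unfolding LD_event_eq_good
  by (intro sets_restrict_tau sets_good edge_closed_cube zero_in_lattice finite_edges_in_cube edges_in_subset)

lemma prob_restrict_tau:
  assumes "E \<subseteq> edges" "E \<noteq> {}" "S \<in> sets (PiM E (\<lambda>_. \<nu>))"
  shows "prob {\<omega> \<in> space M. (\<lambda>e\<in>E. \<tau> e \<omega>) \<in> S} = measure (PiM E (\<lambda>_. \<nu>)) S"
proof -
  have "measure (PiM E (\<lambda>_. \<nu>)) S = measure (distr M (PiM E (\<lambda>_. \<nu>)) (\<lambda>\<omega>. \<lambda>e\<in>E. \<tau> e \<omega>)) S"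
    by (simp only: distr_restrict_tau[OF assms(1,2)])
  also have "\<dots> = prob ((\<lambda>\<omega>. \<lambda>e\<in>E. \<tau> e \<omega>) -` S \<inter> space M)"
    by (rule measure_distr[OF measurable_restrict_tau[OF assms(1)] assms(3)])
  finally show ?thesis by (simp add: vimage_def Int_def conj_commute)
qed

text \<open>Both probabilities are values of product measures with the same factor
  \<open>\<nu>\<close>, and relabelling the edges by the translation carries one product to the
  other.\<close>

lemma prob_good_translate:
  assumes v: "v \<in> lattice" and X: "edge_closed X" "finite (edges_in X)" "edges_in X \<noteq> {}"
    and vX: "edge_closed ((+) v ` X)"
  shows "prob {\<omega> \<in> space M. (\<lambda>e\<in>edges_in ((+) v ` X). \<tau> e \<omega>) \<in> good c ((+) v ` X)} =
     prob {\<omega> \<in> space M. (\<lambda>e\<in>edges_in X. \<tau> e \<omega>) \<in> good c X}"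
proof -
  let ?E = "edges_in X" and ?E' = "edges_in ((+) v ` X)"
  let ?P = "PiM ?E (\<lambda>_. \<nu>)" and ?P' = "PiM ?E' (\<lambda>_. \<nu>)"
  define f :: "(real ^ 'n) set \<Rightarrow> (real ^ 'n) set" where "f e = (+) v ` e" for e
  define h where "h t = (\<lambda>e\<in>?E. t (f e))" for t :: "(real ^ 'n) set \<Rightarrow> real"
  have E': "?E' = f ` ?E" unfolding edges_in_translate[OF v] f_def ..
  have "inj_on f ?E" unfolding f_def by (intro inj_onI) (simp add: inj_image_eq_iff)
  moreover have f: "f \<in> ?E \<rightarrow> ?E'" unfolding E' by auto
  ultimately have distr: "distr ?P' ?P h = ?P"
    unfolding h_def using distr_PiM_reindex[of ?E' "\<lambda>_. \<nu>" f ?E] prob_space_nu by simp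
  have h: "h \<in> measurable ?P' ?P"
    unfolding h_def using f by (intro measurable_restrict measurable_component_singleton) auto
  have "h -` good c X \<inter> space ?P' = good c ((+) v ` X)"
  proof (intro set_eqI iffI)
    fix t assume "t \<in> h -` good c X \<inter> space ?P'"
    then have t: "t \<in> space ?P'" "close_to_norm b g c X (h t)" unfolding good_def by auto
    moreover have "close_to_norm b g c X (h t) \<longleftrightarrow> close_to_norm b g c X (\<lambda>e. t ((+) v ` e))"
      by (rule close_to_norm_cong[OF X(1)]) (simp add: h_def f_def)
    ultimately show "t \<in> good c ((+) v ` X)"
      unfolding good_def close_to_norm_translate[OF v] by simp
  next
    fix t assume "t \<in> good c ((+) v ` X)"
    then have t: "t \<in> space ?P'" "close_to_norm b g c X (\<lambda>e. t ((+) v ` e))"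
      unfolding good_def close_to_norm_translate[OF v] by auto
    moreover have "close_to_norm b g c X (h t) \<longleftrightarrow> close_to_norm b g c X (\<lambda>e. t ((+) v ` e))"
      by (rule close_to_norm_cong[OF X(1)]) (simp add: h_def f_def)
    ultimately show "t \<in> h -` good c X \<inter> space ?P'"
      using measurable_space[OF h] unfolding good_def by auto
  qed
  then have "measure ?P' (good c ((+) v ` X)) = measure (distr ?P' ?P h) (good c X)"
    using measure_distr[OF h sets_good[OF X(1,2)]] by simp
  also have "\<dots> = measure ?P (good c X)" unfolding distr ..
  finally have "measure ?P' (good c ((+) v ` X)) = measure ?P (good c X)" .
  moreover have "finite ?E'" "?E' \<noteq> {}" unfolding E' using X by auto
  moreover have "?E \<subseteq> edges" "?E' \<subseteq> edges" by (rule edges_in_subset)+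
  ultimately show ?thesis
    using X vX by (simp add: prob_restrict_tau sets_good)
qed

text \<open>By independence the left-hand side is the probability that all cores are good and all
  corridor edges slow; \<open>tiling_deviation\<close> shows that, almost surely, this configuration
  forces the event in the large cube.\<close>

lemma prob_LD_event_ge:
  fixes n m N K L :: nat
  assumes n: "0 < n" and m: "0 < m" and L: "L = n + m" and K: "K = N div L" "0 < K"
    and \<delta>: "0 \<le> \<delta>" and lam: "0 \<le> lam" "lam \<le> 1" "lam * b \<le> \<beta>" "\<beta> \<le> b"
      "\<delta> * real n \<le> (\<beta> - lam * b) * real m"
    and err: "(1 - lam) * b * real CARD('n) * real N + (\<delta> * real n + 2 * b * real m) * real CARD('n) * real K
       + \<delta> * real n + 8 * b * real CARD('n) * real L \<le> \<epsilon> * real N"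
  shows "prob (LD_event M \<tau> b unit_cube n g \<delta>) ^ (K ^ CARD('n)) *
      measure \<nu> {x \<in> space \<nu>. \<beta> \<le> x} ^ card (corridor_edges L n K N :: (real ^ 'n) set set)
    \<le> prob (LD_event M \<tau> b unit_cube N g \<epsilon>)"
proof -
  define Q :: "('n \<Rightarrow> int) \<Rightarrow> (real ^ 'n) set" where "Q k = cube (corner L k) (real n)" for k
  define C :: "(real ^ 'n) set set" where "C = corridor_edges L n K N"
  \<comment> \<open>One block per core and one per corridor edge, so that a single independence
    statement covers both kinds.\<close>
  define J where "J = (index_box K :: ('n \<Rightarrow> int) set) <+> C"
  define E where "E = case_sum (\<lambda>k. edges_in (Q k)) (\<lambda>e. {e})"
  define S where "S = case_sum (\<lambda>k. good (\<delta> * real n) (Q k))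
     (\<lambda>e. {t \<in> space (PiM {e} (\<lambda>_. \<nu>)). \<beta> \<le> t e})"
  have E_simps [simp]: "E (Inl k) = edges_in (Q k)" "E (Inr e) = {e}" for k e by (auto simp: E_def)
  have S_simps [simp]: "S (Inl k) = good (\<delta> * real n) (Q k)"
    "S (Inr e) = {t \<in> space (PiM {e} (\<lambda>_. \<nu>)). \<beta> \<le> t e}" for k e by (auto simp: S_def)
  have N: "0 < N" using K by (cases N) auto
  have L0: "0 < L" using L n by simp
  have Q_translate: "Q k = (+) (corner L k) ` cube 0 (real n)" for k
    unfolding Q_def cube_translate by simp
  have closed: "edge_closed (Q k)" for k unfolding Q_def by (rule edge_closed_cube[OF corner_lattice])
  have closed0: "edge_closed (cube 0 (real k) :: (real ^ 'n) set)" for k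
    by (rule edge_closed_cube[OF zero_in_lattice])
  have finE: "finite (edges_in (Q k))" for k
    unfolding Q_translate edges_in_translate[OF corner_lattice]
    by (intro finite_imageI finite_edges_in_cube)
  have C_edges: "C \<subseteq> edges" unfolding C_def corridor_edges_def edges_in_def by auto
  have finC: "finite C" unfolding C_def corridor_edges_def using finite_edges_in_cube by blast
  have edge0: "{0, 0 + axis undefined 1} \<in> edges_in (cube 0 (real n) :: (real ^ 'n) set)"
    unfolding edges_in_def using edge_intro[OF zero_in_lattice] n by (auto simp: cube_def axis_def)
  have J: "finite J" "J \<noteq> {}"
  proof -
    show "finite J" unfolding J_def using finC by simp
    have "(\<lambda>_. 0) \<in> index_box K" using K(2) unfolding index_box_def by simp
    then show "J \<noteq> {}" unfolding J_def by blast
  qed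
  have E_edges: "E j \<subseteq> edges" if "j \<in> J" for j
    using that C_edges unfolding J_def by (auto simp: edges_in_def)
  \<comment> \<open>A common edge would put a vertex in both cores, against the positive gap
    \<open>m\<close>.\<close>
  have disj_Q: "edges_in (Q k) \<inter> edges_in (Q k') = {}" if "k \<noteq> k'" for k k'
  proof (rule ccontr)
    assume "edges_in (Q k) \<inter> edges_in (Q k') \<noteq> {}"
    then obtain e where e: "e \<in> edges" "e \<subseteq> Q k" "e \<subseteq> Q k'" unfolding edges_in_def by blast
    obtain v i where "e = {v, v + axis i 1}" using e(1) by (rule edgesE)
    then have "v \<in> Q k" "v \<in> Q k'" using e by auto
    then have "real m \<le> l1norm (v - v)" unfolding Q_def by (rule core_gap[OF L that])
    then show False using m by simp
  qed
  have disj_C: "e \<notin> edges_in (Q k)" if "e \<in> C" "k \<in> index_box K" for e k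
    using that unfolding C_def corridor_edges_def Q_def by blast
  have disj: "disjoint_family_on E J"
    unfolding disjoint_family_on_def
  proof (intro ballI impI)
    fix i j assume "i \<in> J" "j \<in> J" "i \<noteq> j"
    then show "E i \<inter> E j = {}"
      unfolding J_def by (cases i; cases j) (simp_all add: disj_Q disj_C Plus_def image_iff)
  qed
  have S_sets: "S j \<in> sets (PiM (E j) (\<lambda>_. \<nu>))" if "j \<in> J" for j
  proof (cases j)
    case (Inl k)
    then show ?thesis using sets_good[OF closed finE] by simp
  next
    case (Inr e)
    have "{x \<in> space \<nu>. \<beta> \<le> x} \<in> sets \<nu>"
      using sets_nu_Int[of "{\<beta>..}"] by (simp add: Int_def conj_commute)
    then have "(\<lambda>t. t e) -` {x \<in> space \<nu>. \<beta> \<le> x} \<inter> space (PiM {e} (\<lambda>_. \<nu>)) \<in> sets (PiM {e} (\<lambda>_. \<nu>))"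
      by (intro measurable_sets[OF measurable_component_singleton]) auto
    also have "(\<lambda>t. t e) -` {x \<in> space \<nu>. \<beta> \<le> x} \<inter> space (PiM {e} (\<lambda>_. \<nu>)) = S j"
      unfolding Inr by (auto simp: space_PiM)
    finally show ?thesis unfolding Inr by simp
  qed
  define A where "A = {\<omega> \<in> space M. \<forall>j\<in>J. (\<lambda>e\<in>E j. \<tau> e \<omega>) \<in> S j}"
  have prob_Inl: "prob {\<omega> \<in> space M. (\<lambda>e\<in>E (Inl k). \<tau> e \<omega>) \<in> S (Inl k)} =
      prob (LD_event M \<tau> b unit_cube n g \<delta>)" for k
    unfolding LD_event_eq_good[OF n] E_simps S_simps Q_translate
    using edge0 finite_edges_in_cube closed0 closed[of k]
    by (intro prob_good_translate corner_lattice) (auto simp: Q_translate)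
  have prob_Inr: "prob {\<omega> \<in> space M. (\<lambda>e\<in>E (Inr e). \<tau> e \<omega>) \<in> S (Inr e)} =
      measure \<nu> {x \<in> space \<nu>. \<beta> \<le> x}" if "e \<in> C" for e
  proof -
    have e: "e \<in> edges" using that C_edges by blast
    have "{x \<in> space \<nu>. \<beta> \<le> x} \<in> sets \<nu>"
      using sets_nu_Int[of "{\<beta>..}"] by (simp add: Int_def conj_commute)
    then have "measure (distr M \<nu> (\<tau> e)) {x \<in> space \<nu>. \<beta> \<le> x} =
        prob (\<tau> e -` {x \<in> space \<nu>. \<beta> \<le> x} \<inter> space M)"
      by (rule measure_distr[OF measurable_tau[OF e]])
    also have "\<tau> e -` {x \<in> space \<nu>. \<beta> \<le> x} \<inter> space M =
        {\<omega> \<in> space M. (\<lambda>e\<in>E (Inr e). \<tau> e \<omega>) \<in> S (Inr e)}"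
      using measurable_space[OF measurable_tau[OF e]] by (auto simp: space_PiM)
    finally show ?thesis unfolding distr_tau[OF e] ..
  qed
  have "prob A = (\<Prod>j\<in>J. prob {\<omega> \<in> space M. (\<lambda>e\<in>E j. \<tau> e \<omega>) \<in> S j})"
    unfolding A_def by (rule prob_blocks[OF J E_edges disj S_sets])
  also have "\<dots> = (\<Prod>k\<in>(index_box K :: ('n \<Rightarrow> int) set). prob (LD_event M \<tau> b unit_cube n g \<delta>)) *
      (\<Prod>e\<in>C. measure \<nu> {x \<in> space \<nu>. \<beta> \<le> x})"
    unfolding J_def using finC prob_Inl prob_Inr by (subst prod.Plus) (auto simp: comp_def)
  finally have prob_A: "prob A = prob (LD_event M \<tau> b unit_cube n g \<delta>) ^ (K ^ CARD('n)) *
      measure \<nu> {x \<in> space \<nu>. \<beta> \<le> x} ^ card C"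
    by (simp add: card_index_box)
  \<comment> \<open>Times above \<open>b\<close> are excluded only almost surely, hence the
    inclusion of events is stated almost everywhere.\<close>
  have "AE \<omega> in M. \<forall>e\<in>edges_in (cube 0 (real N)). \<tau> e \<omega> \<le> b"
    using edges_in_subset AE_tau_le by (intro AE_finite_allI finite_edges_in_cube) blast
  moreover have "AE \<omega> in M. \<omega> \<in> space M" by (rule AE_space)
  ultimately have "AE \<omega> in M. \<omega> \<in> A \<longrightarrow> \<omega> \<in> LD_event M \<tau> b unit_cube N g \<epsilon>"
  proof eventually_elim
    case (elim \<omega>)
    show ?case
    proof
      assume "\<omega> \<in> A"
      then have block: "(\<lambda>e\<in>E j. \<tau> e \<omega>) \<in> S j" if "j \<in> J" for j using that unfolding A_def by blast
      have core: "close_to_norm b g (\<delta> * real n) (Q k) (\<lambda>e. \<tau> e \<omega>)" if "k \<in> index_box K" for k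
        using block[of "Inl k"] that restrict_tau_in_good_iff[OF closed elim(2)] by (auto simp: J_def)
      have corridor: "\<beta> \<le> \<tau> e \<omega>" if "e \<in> C" for e
        using block[of "Inr e"] that by (auto simp: J_def)
      have "close_to_norm b g (\<epsilon> * real N) (cube 0 (real N)) (\<lambda>e. \<tau> e \<omega>)"
        unfolding close_to_norm_def
      proof (intro ballI order_trans[OF _ err])
        fix x y :: "real ^ 'n" assume xy: "x \<in> cube 0 (real N)" "y \<in> cube 0 (real N)"
        show "\<bar>g (x - y) - passage_time b (\<lambda>e. \<tau> e \<omega>) (cube 0 (real N)) x y\<bar> \<le>
          (1 - lam) * b * real CARD('n) * real N + (\<delta> * real n + 2 * b * real m) * real CARD('n) * real K
           + \<delta> * real n + 8 * b * real CARD('n) * real L"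
        proof (rule tiling_deviation[where n = n and D = "\<delta> * real n" and \<beta> = \<beta>])
        show "\<forall>e\<in>edges_in (cube 0 (real N)). 0 \<le> \<tau> e \<omega> \<and> \<tau> e \<omega> \<le> b"
          using elim tau_nonneg edges_in_subset by blast
        show "\<bar>g (u - v) - passage_time b (\<lambda>e. \<tau> e \<omega>) (cube (corner L k) (real n)) u v\<bar> \<le> \<delta> * real n"
          if "\<And>i. 0 \<le> k i \<and> k i < int K" "u \<in> cube (corner L k) (real n)" "v \<in> cube (corner L k) (real n)"
          for k u v
          using core[of k] that unfolding close_to_norm_def Q_def index_box_def by blast
        show "\<beta> \<le> \<tau> e \<omega>" if "e \<in> edges_in (cube 0 (real N))"
          "\<And>k. (\<And>i. 0 \<le> k i \<and> k i < int K) \<Longrightarrow> \<not> e \<subseteq> cube (corner L k) (real n)" for e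
          using that by (intro corridor) (auto simp: C_def corridor_edges_def edges_in_def index_box_def)
        qed (use L L0 K \<delta> b_pos lam norm_g g_le xy in auto)
      qed
      then show "\<omega> \<in> LD_event M \<tau> b unit_cube N g \<epsilon>"
        unfolding LD_event_eq[OF N norm_g] using elim(2) by simp
    qed
  qed
  then have "prob A \<le> prob (LD_event M \<tau> b unit_cube N g \<epsilon>)"
    using LD_event_in_events[OF N] by (rule finite_measure_mono_AE)
  then show ?thesis unfolding prob_A C_def .
qed

end

section \<open>The rate functions\<close>

lemma neg_log_antimono: "0 \<le> p \<Longrightarrow> p \<le> q \<Longrightarrow> neg_log q \<le> neg_log p"
  by (auto simp: neg_log_def)

text \<open>Monotonicity turns the limit into a supremum, the form in which both rates are handled
  from here on.\<close>

lemma at_right_0_SUP: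
  fixes f :: "real \<Rightarrow> ereal"
  assumes "\<And>x y. 0 < x \<Longrightarrow> x \<le> y \<Longrightarrow> f y \<le> f x"
  shows "Lim (at_right 0) f = (SUP x\<in>{0<..}. f x)"
proof (rule tendsto_Lim)
  show "(f \<longlongrightarrow> (SUP x\<in>{0<..}. f x)) (at_right 0)"
  proof (rule increasing_tendsto)
    show "\<forall>\<^sub>F x in at_right 0. f x \<le> (SUP x\<in>{0<..}. f x)"
      unfolding eventually_at_right_field by (auto intro!: exI[of _ 1] SUP_upper)
    fix l assume "l < (SUP x\<in>{0<..}. f x)"
    then obtain x where x: "0 < x" "l < f x" by (auto simp: less_SUP_iff)
    have "l < f y" if "0 < y" "y < x" for y
      using x(2) assms[of y x] that by (auto intro: less_le_trans)
    then show "\<forall>\<^sub>F x in at_right 0. l < f x"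
      unfolding eventually_at_right_field using x(1) by blast
  qed
qed simp

text \<open>The limit is the share of volume not covered by cores in one period cell; the shift in
  \<open>Suc N\<close> and the incomplete period at the boundary disappear asymptotically.\<close>

lemma corridor_fraction_tendsto:
  fixes n L d :: nat
  assumes "0 < L"
  shows "(\<lambda>N. (real (Suc N) ^ d - (real (N div L) * real n) ^ d) / real N ^ d)
     \<longlonglongrightarrow> 1 - (real n / real L) ^ d"
proof -
  have "(\<lambda>N. real (N div L) / real N) \<longlonglongrightarrow> 1 / real L"
  proof (rule tendsto_sandwich)
    show "\<forall>\<^sub>F N in sequentially. 1 / real L - 1 / real N \<le> real (N div L) / real N"
      using eventually_gt_at_top[of 0]
    proof eventually_elim
      case (elim N)
      have "N < L * (N div L) + L"
        using assms by (metis dividend_less_times_div add.commute mult.commute)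
      then have "real N < real L * real (N div L) + real L" by (metis of_nat_add of_nat_less_iff of_nat_mult)
      then have "(real N - real L) / (real L * real N) \<le> real L * real (N div L) / (real L * real N)"
        by (intro divide_right_mono) auto
      then show ?case using elim assms by (simp add: diff_divide_distrib)
    qed
    show "\<forall>\<^sub>F N in sequentially. real (N div L) / real N \<le> 1 / real L"
      using eventually_gt_at_top[of 0]
    proof eventually_elim
      case (elim N)
      have "real (N div L) * real L \<le> real N" by (metis div_times_less_eq_dividend of_nat_le_iff of_nat_mult)
      then show ?case using elim assms by (simp add: field_simps)
    qed
    have "(\<lambda>N. 1 / real L - 1 / real N) \<longlonglongrightarrow> 1 / real L - 0"
      by (intro tendsto_intros lim_1_over_n)
    then show "(\<lambda>N. 1 / real L - 1 / real N) \<longlonglongrightarrow> 1 / real L" by simp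
  qed auto
  then have div: "(\<lambda>N. (real (N div L) / real N * real n) ^ d) \<longlonglongrightarrow> (1 / real L * real n) ^ d"
    by (intro tendsto_power tendsto_mult tendsto_const)
  have one: "(\<lambda>N. (1 + 1 / real N) ^ d) \<longlonglongrightarrow> (1 + 0) ^ d"
    by (intro tendsto_intros lim_1_over_n)
  have "(\<lambda>N. (1 + 1 / real N) ^ d - (real (N div L) / real N * real n) ^ d)
      \<longlonglongrightarrow> (1 + 0) ^ d - (1 / real L * real n) ^ d"
    by (rule tendsto_diff[OF one div])
  moreover have "\<forall>\<^sub>F N in sequentially.
      (1 + 1 / real N) ^ d - (real (N div L) / real N * real n) ^ d =
      (real (Suc N) ^ d - (real (N div L) * real n) ^ d) / real N ^ d"
    using eventually_gt_at_top[of 0]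
  proof eventually_elim
    case (elim N)
    have "1 + 1 / real N = real (Suc N) / real N" using elim by (simp add: field_simps)
    then show ?case by (simp add: power_divide diff_divide_distrib power_mult_distrib)
  qed
  ultimately have "(\<lambda>N. (real (Suc N) ^ d - (real (N div L) * real n) ^ d) / real N ^ d)
     \<longlonglongrightarrow> (1 + 0) ^ d - (1 / real L * real n) ^ d"
    by (rule Lim_transform_eventually)
  then show ?thesis by simp
qed

context iid_passage
begin

lemma LD_rate_antimono:
  assumes "0 < n" "\<epsilon> \<le> \<epsilon>'"
  shows "LD_rate M \<tau> b unit_cube g \<epsilon>' n \<le> LD_rate M \<tau> b unit_cube g \<epsilon> n"
proof -
  have "LD_event M \<tau> b unit_cube n g \<epsilon> \<subseteq> LD_event M \<tau> b unit_cube n g \<epsilon>'"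
    unfolding LD_event_def using assms(2) by (auto intro: order_trans)
  then have "prob (LD_event M \<tau> b unit_cube n g \<epsilon>) \<le> prob (LD_event M \<tau> b unit_cube n g \<epsilon>')"
    by (rule finite_measure_mono[OF _ LD_event_in_events[OF assms(1)]])
  then show ?thesis
    unfolding LD_rate_def using assms(1)
    by (intro ereal_divide_right_mono neg_log_antimono) auto
qed

lemma lower_rate_eq: "lower_rate M \<tau> b unit_cube g = (SUP \<epsilon>\<in>{0<..}. liminf (LD_rate M \<tau> b unit_cube g \<epsilon>))"
  unfolding lower_rate_def
proof (rule at_right_0_SUP)
  fix x y :: real assume "x \<le> y"
  then show "liminf (LD_rate M \<tau> b unit_cube g y) \<le> liminf (LD_rate M \<tau> b unit_cube g x)"
    by (intro Liminf_mono eventually_mono[OF eventually_gt_at_top[of 0]] LD_rate_antimono)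
qed

lemma upper_rate_eq: "upper_rate M \<tau> b unit_cube g = (SUP \<epsilon>\<in>{0<..}. limsup (LD_rate M \<tau> b unit_cube g \<epsilon>))"
  unfolding upper_rate_def
proof (rule at_right_0_SUP)
  fix x y :: real assume "x \<le> y"
  then show "limsup (LD_rate M \<tau> b unit_cube g y) \<le> limsup (LD_rate M \<tau> b unit_cube g x)"
    by (intro Limsup_mono eventually_mono[OF eventually_gt_at_top[of 0]] LD_rate_antimono)
qed

text \<open>Each of four groups of error terms in \<open>prob_LD_event_ge\<close> gets a share
  \<open>\<epsilon> / 5\<close>. One \<open>\<zeta>\<close> is spent on approaching the liminf at a
  single \<open>n\<close>, the other on the corridor edges.\<close>

lemma limsup_LD_rate_le:
  assumes liminf: "\<And>\<delta>. 0 < \<delta> \<Longrightarrow> liminf (LD_rate M \<tau> b unit_cube g \<delta>) \<le> ereal I"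
    and \<epsilon>: "0 < \<epsilon>" and \<zeta>: "0 < \<zeta>"
  shows "limsup (LD_rate M \<tau> b unit_cube g \<epsilon>) \<le> ereal (I + 2 * \<zeta>)"
proof -
  define d where "d = CARD('n)"
  have d: "0 < real d" "0 < d" unfolding d_def by auto
  \<comment> \<open>\<open>\<kappa>\<close> is \<open>1 - lam\<close>; its second bound keeps
    \<open>\<kappa> * b * d\<close>, the loss from scaling \<open>g\<close>, at most
    \<open>\<epsilon> / 5\<close>.\<close>
  define \<kappa> where "\<kappa> = min (1/2) (\<epsilon> / (5 * b * real d))"
  have \<kappa>: "0 < \<kappa>" "\<kappa> \<le> 1/2" "\<kappa> * b * real d \<le> \<epsilon> / 5"
  proof -
    show "0 < \<kappa>" "\<kappa> \<le> 1/2" using \<epsilon> b_pos d unfolding \<kappa>_def by auto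
    have "\<kappa> \<le> \<epsilon> / (5 * b * real d)" unfolding \<kappa>_def by simp
    then show "\<kappa> * b * real d \<le> \<epsilon> / 5" using b_pos d by (simp add: field_simps)
  qed
  \<comment> \<open>Midway between \<open>lam * b\<close> and \<open>b\<close>: the distance
    \<open>\<kappa> * b / 2\<close> to \<open>lam * b\<close> is the surplus per unit length in the
    gaps, and \<open>\<beta> < b\<close> is what \<open>tail_pos\<close> asks for.\<close>
  define \<beta> where "\<beta> = b - \<kappa> * b / 2"
  have \<beta>: "\<beta> < b" using \<kappa> b_pos unfolding \<beta>_def by simp
  define q where "q = measure \<nu> {x \<in> space \<nu>. \<beta> \<le> x}"
  interpret nu: prob_space \<nu> by (rule prob_space_nu)
  have q: "0 < q" "q \<le> 1" using tail_pos[OF \<beta>] unfolding q_def by auto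
  \<comment> \<open>\<open>h \<eta>\<close> will bound the limiting corridor cost per unit of
    \<open>N ^ d\<close>: with \<open>m \<le> 2 * \<eta> * n\<close>, the ratio \<open>n / L\<close>
    is at least \<open>1 / (1 + 2 * \<eta>)\<close>.\<close>
  define h where "h \<eta> = real d * (- ln q) * (1 - (1 / (1 + 2 * \<eta>)) ^ d)" for \<eta> :: real
  have "((\<lambda>\<eta>. h \<eta>) \<longlongrightarrow> real d * (- ln q) * (1 - (1 / (1 + 2 * 0)) ^ d)) (at_right 0)"
    unfolding h_def by (intro tendsto_intros) auto
  then have "(h \<longlongrightarrow> 0) (at_right 0)" by simp
  then have "\<forall>\<^sub>F \<eta> in at_right 0. h \<eta> < \<zeta>" using \<zeta> by (rule order_tendstoD)
  moreover have "\<forall>\<^sub>F \<eta> in at_right 0. \<eta> < \<epsilon> / (20 * b * real d)"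
    using \<epsilon> b_pos d by (intro eventually_at_right_less[THEN filter_leD[rotated]] order_tendstoD(2)[OF tendsto_ident_at]) auto
  moreover have "\<forall>\<^sub>F \<eta> in at_right 0. 0 < (\<eta>::real)" by (rule eventually_at_right_less)
  ultimately have "\<forall>\<^sub>F \<eta> in at_right 0. h \<eta> < \<zeta> \<and> \<eta> < \<epsilon> / (20 * b * real d) \<and> 0 < \<eta>"
    by eventually_elim auto
  then obtain \<eta> where \<eta>: "h \<eta> < \<zeta>" "\<eta> < \<epsilon> / (20 * b * real d)" "0 < \<eta>"
    using eventually_happens'[of "at_right (0::real)"] by auto
  have \<eta>': "4 * b * real d * \<eta> \<le> \<epsilon> / 5" using \<eta>(2) b_pos d by (simp add: field_simps)
  \<comment> \<open>The first bound yields the gap condition, since \<open>m\<close> will be at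
    least \<open>\<eta> * n\<close>; the second controls \<open>d * K\<close> errors of size
    \<open>\<delta> * n\<close>, as \<open>K * n \<le> N\<close>.\<close>
  define \<delta> where "\<delta> = min (\<eta> * (\<kappa> * b / 2)) (\<epsilon> / (5 * real d))"
  have \<delta>: "0 < \<delta>" "\<delta> \<le> \<eta> * (\<kappa> * b / 2)" "\<delta> * real d \<le> \<epsilon> / 5"
  proof -
    show "0 < \<delta>" "\<delta> \<le> \<eta> * (\<kappa> * b / 2)" using \<eta> \<kappa> b_pos \<epsilon> d unfolding \<delta>_def by auto
    have "\<delta> \<le> \<epsilon> / (5 * real d)" unfolding \<delta>_def by simp
    then show "\<delta> * real d \<le> \<epsilon> / 5" using d by (simp add: field_simps)
  qed
  \<comment> \<open>Guarantees \<open>\<eta> * n \<ge> 1\<close>, so that rounding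
    \<open>\<eta> * n\<close> up to \<open>m\<close> at most doubles it.\<close>
  define n0 where "n0 = Suc (nat \<lceil>1 / \<eta>\<rceil>)"
  \<comment> \<open>The liminf is at most \<open>I\<close>, so rates below
    \<open>I + \<zeta>\<close> recur at arbitrarily large \<open>n\<close>.\<close>
  have "\<exists>n\<ge>n0. LD_rate M \<tau> b unit_cube g \<delta> n < ereal (I + \<zeta>)"
  proof (rule ccontr)
    assume "\<not> ?thesis"
    then have "\<forall>\<^sub>F n in sequentially. ereal (I + \<zeta>) \<le> LD_rate M \<tau> b unit_cube g \<delta> n"
      unfolding eventually_sequentially by (intro exI[of _ n0]) (auto simp: not_less)
    then have "ereal (I + \<zeta>) \<le> liminf (LD_rate M \<tau> b unit_cube g \<delta>)" by (rule Liminf_bounded)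
    then have "ereal (I + \<zeta>) \<le> ereal I" using liminf[OF \<delta>(1)] by (rule order_trans)
    then show False using \<zeta> by simp
  qed
  then obtain n where n: "n0 \<le> n" "LD_rate M \<tau> b unit_cube g \<delta> n < ereal (I + \<zeta>)" by blast
  have n_pos: "0 < n" using n(1) unfolding n0_def by simp
  have n_ge: "1 \<le> \<eta> * real n"
  proof -
    have "1 / \<eta> \<le> real n0" unfolding n0_def by linarith
    also have "\<dots> \<le> real n" using n(1) by simp
    finally show ?thesis using \<eta>(3) by (simp add: field_simps)
  qed
  define p where "p = prob (LD_event M \<tau> b unit_cube n g \<delta>)"
  have p: "0 < p" "p \<le> 1" "- ln p \<le> (I + \<zeta>) * real n ^ d"
  proof -
    have nd: "0 < real n ^ d" using n_pos by simp
    have "p \<noteq> 0"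
      using n(2) nd unfolding LD_rate_def p_def[symmetric] d_def[symmetric] neg_log_def by auto
    moreover have "0 \<le> p" unfolding p_def by simp
    ultimately show "0 < p" by simp
    show "p \<le> 1" unfolding p_def by simp
    have "ereal (- ln p / real n ^ d) < ereal (I + \<zeta>)"
      using n(2) n_pos \<open>p \<noteq> 0\<close> unfolding LD_rate_def p_def[symmetric] d_def[symmetric] neg_log_def
      by simp
    then show "- ln p \<le> (I + \<zeta>) * real n ^ d" using nd by (simp add: field_simps)
  qed
  define m where "m = nat \<lceil>\<eta> * real n\<rceil>"
  have m: "\<eta> * real n \<le> real m" "real m \<le> 2 * (\<eta> * real n)" "0 < m"
    using n_ge unfolding m_def by linarith+
  define L where "L = n + m"
  have L: "0 < L" unfolding L_def using n_pos by simp
  define c where "c N = real d * (- ln q) * ((real (Suc N) ^ d - (real (N div L) * real n) ^ d) / real N ^ d)" for N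
  have "1 / (1 + 2 * \<eta>) \<le> real n / real L"
    using m(2) \<eta>(3) n_pos unfolding L_def by (simp add: field_simps)
  then have "(1 / (1 + 2 * \<eta>)) ^ d \<le> (real n / real L) ^ d"
    using \<eta>(3) by (intro power_mono) auto
  then have "real d * (- ln q) * (1 - (real n / real L) ^ d) \<le> h \<eta>"
    unfolding h_def using q by (intro mult_left_mono mult_nonneg_nonneg) auto
  then have lim: "real d * (- ln q) * (1 - (real n / real L) ^ d) < \<zeta>" using \<eta>(1) by simp
  have "c \<longlonglongrightarrow> real d * (- ln q) * (1 - (real n / real L) ^ d)"
    unfolding c_def by (intro tendsto_intros corridor_fraction_tendsto L)
  then have ev1: "\<forall>\<^sub>F N in sequentially. c N < \<zeta>" using lim by (rule order_tendstoD)
  \<comment> \<open>From here on the error terms that do not grow with \<open>N\<close> fit into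
    their share \<open>\<epsilon> / 5 * N\<close>.\<close>
  have ev2: "\<forall>\<^sub>F N in sequentially. (\<delta> * real n + 8 * b * real d * real L) / (\<epsilon> / 5) \<le> real N"
    using filterlim_real_sequentially unfolding filterlim_at_top by blast
  have ev3: "\<forall>\<^sub>F N in sequentially. L \<le> N" by (rule eventually_ge_at_top)
  have "\<forall>\<^sub>F N in sequentially. LD_rate M \<tau> b unit_cube g \<epsilon> N \<le> ereal (I + 2 * \<zeta>)"
    using ev1 ev2 ev3
  proof eventually_elim
    case (elim N)
    define K where "K = N div L"
    have K: "0 < K" unfolding K_def using elim(3) L by (simp add: div_greater_zero_iff)
    have N: "0 < real N" using elim(3) L by simp
    have KL: "real K * real L \<le> real N" unfolding K_def by (metis div_times_less_eq_dividend of_nat_le_iff of_nat_mult)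
    have Kn: "real K * real n \<le> real N"
      using KL mult_left_mono[of "real n" "real L" "real K"] unfolding L_def by simp
    have "prob (LD_event M \<tau> b unit_cube n g \<delta>) ^ (K ^ CARD('n)) *
        measure \<nu> {x \<in> space \<nu>. \<beta> \<le> x} ^ card (corridor_edges L n K N :: (real ^ 'n) set set)
      \<le> prob (LD_event M \<tau> b unit_cube N g \<epsilon>)"
    proof (rule prob_LD_event_ge[where lam = "1 - \<kappa>"])
      show "\<delta> * real n \<le> (\<beta> - (1 - \<kappa>) * b) * real m"
      proof -
        have "\<delta> * real n \<le> (\<eta> * (\<kappa> * b / 2)) * real n" using \<delta>(2) by (intro mult_right_mono) auto
        also have "\<dots> = (\<kappa> * b / 2) * (\<eta> * real n)" by simp
        also have "\<dots> \<le> (\<kappa> * b / 2) * real m" using m(1) \<kappa> b_pos by (intro mult_left_mono) auto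
        also have "\<dots> = (\<beta> - (1 - \<kappa>) * b) * real m" unfolding \<beta>_def by (simp add: algebra_simps)
        finally show ?thesis .
      qed
      show "(1 - (1 - \<kappa>)) * b * real CARD('n) * real N
         + (\<delta> * real n + 2 * b * real m) * real CARD('n) * real K
         + \<delta> * real n + 8 * b * real CARD('n) * real L \<le> \<epsilon> * real N"
      proof -
        have 1: "\<kappa> * b * real d * real N \<le> \<epsilon> / 5 * real N" using \<kappa>(3) by (intro mult_right_mono) auto
        have "\<delta> * real d * (real K * real n) \<le> \<epsilon> / 5 * real N"
          using \<delta> Kn \<epsilon> by (intro mult_mono) auto
        then have 2: "\<delta> * real n * real d * real K \<le> \<epsilon> / 5 * real N" by (simp add: mult.assoc mult.left_commute mult.commute)
        have "2 * b * real d * real K * real m \<le> 2 * b * real d * real K * (2 * (\<eta> * real n))"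
          using m(2) b_pos by (intro mult_left_mono) auto
        also have "\<dots> = (4 * b * real d * \<eta>) * (real K * real n)" by simp
        also have "\<dots> \<le> \<epsilon> / 5 * real N" using \<eta>' Kn \<epsilon> by (intro mult_mono) auto
        finally have 3: "2 * b * real m * real d * real K \<le> \<epsilon> / 5 * real N" by (simp add: mult.assoc mult.left_commute mult.commute)
        have 4: "\<delta> * real n + 8 * b * real d * real L \<le> \<epsilon> / 5 * real N"
          using elim(2) \<epsilon> by (simp add: field_simps)
        have "0 \<le> \<epsilon> * real N" using \<epsilon> by simp
        then show ?thesis using 1 2 3 4 unfolding d_def[symmetric] by (simp add: distrib_right)
      qed
      show "(1 - \<kappa>) * b \<le> \<beta>" unfolding \<beta>_def using \<kappa> b_pos by (simp add: algebra_simps)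
    qed (use n_pos m \<kappa> \<delta> \<beta> K in \<open>auto simp: L_def K_def\<close>)
    moreover define P where "P = prob (LD_event M \<tau> b unit_cube N g \<epsilon>)"
    moreover define C where "C = card (corridor_edges L n K N :: (real ^ 'n) set set)"
    ultimately have le: "p ^ (K ^ d) * q ^ C \<le> P" unfolding p_def q_def d_def by simp
    have pos: "0 < p ^ (K ^ d) * q ^ C" using p q by simp
    have "- ln P \<le> - ln (p ^ (K ^ d) * q ^ C)" using le pos by simp
    also have "\<dots> = real K ^ d * (- ln p) + real C * (- ln q)"
      using p q by (simp add: ln_mult ln_realpow)
    also have "\<dots> \<le> (I + \<zeta>) * real N ^ d + c N * real N ^ d"
    proof (rule add_mono)
      have nd: "0 < real n ^ d" using n_pos by simp
      have "0 \<le> - ln p" using p by simp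
      \<comment> \<open>Nonnegativity of \<open>I + \<zeta>\<close> permits enlarging
        \<open>(K * n) ^ d\<close> to \<open>N ^ d\<close> below.\<close>
      then have I\<zeta>: "0 \<le> I + \<zeta>" using p(3) nd by (smt (verit) zero_le_mult_iff)
      have "real K ^ d * (- ln p) \<le> real K ^ d * ((I + \<zeta>) * real n ^ d)"
        using p(3) by (intro mult_left_mono) auto
      also have "\<dots> = (I + \<zeta>) * (real K * real n) ^ d" by (simp add: power_mult_distrib)
      also have "\<dots> \<le> (I + \<zeta>) * real N ^ d" using Kn I\<zeta> by (intro mult_left_mono power_mono) auto
      finally show "real K ^ d * (- ln p) \<le> (I + \<zeta>) * real N ^ d" .
      have "real C * (- ln q) \<le> real d * (real (Suc N) ^ d - (real K * real n) ^ d) * (- ln q)"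
        unfolding C_def d_def using q card_corridor_edges[where 'n = 'n, OF L_def L K_def]
        by (intro mult_right_mono) auto
      also have "\<dots> = c N * real N ^ d" unfolding c_def K_def using N by simp
      finally show "real C * (- ln q) \<le> c N * real N ^ d" .
    qed
    also have "\<dots> \<le> (I + \<zeta>) * real N ^ d + \<zeta> * real N ^ d"
      using elim(1) by (intro add_left_mono mult_right_mono) auto
    finally have "- ln P / real N ^ d \<le> I + 2 * \<zeta>"
      using N by (simp add: field_simps)
    then show ?case
      using le pos N unfolding LD_rate_def P_def[symmetric] d_def[symmetric] neg_log_def by auto
  qed
  then show ?thesis by (rule Limsup_bounded)
qed

text \<open>An infinite lower rate leaves nothing to prove for the hard inequality, and
  nonnegativity of the rates excludes \<open>-\<infinity>\<close>; for a finite value,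
  \<open>limsup_LD_rate_le\<close> applies with arbitrarily small \<open>\<zeta>\<close>.\<close>

lemma lower_rate_eq_upper_rate: "lower_rate M \<tau> b unit_cube g = upper_rate M \<tau> b unit_cube g"
proof (rule antisym)
  show "lower_rate M \<tau> b unit_cube g \<le> upper_rate M \<tau> b unit_cube g"
    unfolding lower_rate_eq upper_rate_eq
  proof (rule SUP_mono)
    fix \<epsilon> :: real assume "\<epsilon> \<in> {0<..}"
    then show "\<exists>\<delta>\<in>{0<..}. liminf (LD_rate M \<tau> b unit_cube g \<epsilon>) \<le> limsup (LD_rate M \<tau> b unit_cube g \<delta>)"
      by (intro bexI[of _ \<epsilon>] Liminf_le_Limsup) auto
  qed
  have liminf_le: "liminf (LD_rate M \<tau> b unit_cube g \<delta>) \<le> lower_rate M \<tau> b unit_cube g" if "0 < \<delta>" for \<delta>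
    unfolding lower_rate_eq using that by (intro SUP_upper) simp
  have "0 \<le> liminf (LD_rate M \<tau> b unit_cube g 1)"
  proof (rule Liminf_bounded, rule eventually_mono[OF eventually_gt_at_top[of 0]])
    fix n :: nat assume "0 < n"
    moreover define p where "p = prob (LD_event M \<tau> b unit_cube n g 1)"
    moreover have "ln p \<le> 0" if "p \<noteq> 0"
      using that unfolding p_def by (subst ln_le_zero_iff) (auto simp: zero_less_measure_iff)
    ultimately show "0 \<le> LD_rate M \<tau> b unit_cube g 1 n"
      unfolding LD_rate_def neg_log_def by (auto simp flip: p_def simp: divide_nonpos_nonneg)
  qed
  then have nonneg: "0 \<le> lower_rate M \<tau> b unit_cube g" using liminf_le[of 1] by (simp add: order_trans)
  show "upper_rate M \<tau> b unit_cube g \<le> lower_rate M \<tau> b unit_cube g"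
  proof (cases "lower_rate M \<tau> b unit_cube g")
    case (real I)
    show ?thesis unfolding upper_rate_eq
    proof (rule SUP_least, rule ereal_le_epsilon2)
      fix \<epsilon> \<zeta> :: real assume "\<epsilon> \<in> {0<..}" "0 < \<zeta>"
      then have "limsup (LD_rate M \<tau> b unit_cube g \<epsilon>) \<le> ereal (I + 2 * (\<zeta> / 2))"
        using liminf_le unfolding real by (intro limsup_LD_rate_le) auto
      then show "limsup (LD_rate M \<tau> b unit_cube g \<epsilon>) \<le> lower_rate M \<tau> b unit_cube g + ereal \<zeta>"
        unfolding real by simp
    qed
  qed (use nonneg in auto)
qed

end

theorem theorem1p9:
  fixes M :: "'w measure" and \<nu> :: "real measure"
    and \<tau> :: "(real ^ 'n) set \<Rightarrow> 'w \<Rightarrow> real"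
    and a b :: real
  assumes "CARD('n) \<ge> 2"
    and "prob_space M"
    and "law_on_nonneg \<nu>"
    and "iid_passage_times M \<nu> \<tau>"
    and "ereal a = (INF x\<in>law_support \<nu>. ereal x)"
    and "ereal b = (SUP x\<in>law_support \<nu>. ereal x)"
    and "0 < a" and "a < b"
  shows "\<forall>g\<in>admissible_norms a b. lower_rate M \<tau> b unit_cube g = upper_rate M \<tau> b unit_cube g"
proof
  fix g :: "real ^ 'n \<Rightarrow> real" assume g: "g \<in> admissible_norms a b"
  interpret prob_space M by fact
  interpret iid_passage M \<nu> \<tau> b g
    by unfold_locales (use assms g in \<open>auto simp: admissible_norms_def\<close>)
  show "lower_rate M \<tau> b unit_cube g = upper_rate M \<tau> b unit_cube g"
    by (rule lower_rate_eq_upper_rate)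
qed

end
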